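(* Let $n\geq 3$ and let $\mathcal{L}$ be a Lie algebra of type $M(n,{\bf a},{\bf c},{\bf d})$. Then there exists an ideal $I$ of $\mathrm{gim}(M_n)$ such that $\mathrm{gim}(M_n)/I\cong\mathcal{L}$.
   Context: All Lie algebras are over $\mathbb{C}$. For $n\geq 3$, $M_n=(m_{i,j})_{1\le i,j\le n}$ is the $n\times n$ integer matrix with $m_{i,i}=2$ for all $i$, $m_{i,i+1}=m_{i+1,i}=-1$ for $1\leq i\leq n-1$, $m_{1,n}=m_{n,1}=1$, and all other entries $0$. The Lie algebra $\mathrm{gim}(M_n)$ is the Lie algebra generated by $e_1,\dots,e_n,f_1,\dots,f_n,h_1,\dots,h_n$ subject to the relations: (R1) for all $1\le i,j\le n$: $[h_i,e_j]=m_{i,j}e_j$, $[h_i,f_j]=-m_{i,j}f_j$, $[e_i,f_i]=h_i$; (R2) for $i\neq j$ with $m_{i,j}\leq 0$: $[e_i,f_j]=0=[f_i,e_j]$ and $(\mathrm{ad}\,e_i)^{-m_{i,j}+1}e_j=0=(\mathrm{ad}\,f_i)^{-m_{i,j}+1}f_j$; (R3) for $i\neq j$ with $m_{i,j}>0$: $[e_i,e_j]=0=[f_i,f_j]$ and $(\mathrm{ad}\,e_i)^{m_{i,j}+1}f_j=0=(\mathrm{ad}\,f_i)^{m_{i,j}+1}e_j$. A Lie algebra $\mathcal{L}$ is said to be of type $M(n,{\bf a},{\bf c},{\bf d})$ (where $n\ge 3$, ${\bf a}\in\mathbb{Z}_{\geq 0}$, ${\bf c},{\bf d}\in\{0,1\}$)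 if $\mathcal{L}$ is a non-trivial (nonzero) semisimple Lie algebra isomorphic to a direct sum of ${\bf a}$ copies of $sl_{2n}$, ${\bf c}$ copies of $sp_{2n}$ and ${\bf d}$ copies of $so_{2n}$. *)

theory Defs
  imports Complex_Main
begin

record 'a lie =
  carr :: "'a set"
  zer  :: 'a
  pls  :: "'a \<Rightarrow> 'a \<Rightarrow> 'a"
  scl  :: "complex \<Rightarrow> 'a \<Rightarrow> 'a"
  brk  :: "'a \<Rightarrow> 'a \<Rightarrow> 'a"

definition lsub :: "('a, 'b) lie_scheme \<Rightarrow> 'a \<Rightarrow> 'a \<Rightarrow> 'a" where
  "lsub L x y = pls L x (scl L (-1) y)"

definition lie_algebra :: "('a, 'b) lie_scheme \<Rightarrow> bool" where
  "lie_algebra L \<longleftrightarrow>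
     zer L \<in> carr L \<and>
     (\<forall>x\<in>carr L. \<forall>y\<in>carr L. pls L x y \<in> carr L) \<and>
     (\<forall>a. \<forall>x\<in>carr L. scl L a x \<in> carr L) \<and>
     (\<forall>x\<in>carr L. \<forall>y\<in>carr L. brk L x y \<in> carr L) \<and>
     (\<forall>x\<in>carr L. \<forall>y\<in>carr L. \<forall>z\<in>carr L. pls L (pls L x y) z = pls L x (pls L y z)) \<and>
     (\<forall>x\<in>carr L. \<forall>y\<in>carr L. pls L x y = pls L y x) \<and>
     (\<forall>x\<in>carr L. pls L (zer L) x = x) \<and>
     (\<forall>x\<in>carr L. pls L x (scl L (-1) x) = zer L) \<and>
     (\<forall>x\<in>carr L. scl L 1 x = x) \<and>
     (\<forall>a b. \<forall>x\<in>carr L. scl L a (scl L b x) = scl L (a * b) x) \<and>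
     (\<forall>a b. \<forall>x\<in>carr L. scl L (a + b) x = pls L (scl L a x) (scl L b x)) \<and>
     (\<forall>a. \<forall>x\<in>carr L. \<forall>y\<in>carr L. scl L a (pls L x y) = pls L (scl L a x) (scl L a y)) \<and>
     (\<forall>x\<in>carr L. \<forall>y\<in>carr L. \<forall>z\<in>carr L. brk L (pls L x y) z = pls L (brk L x z) (brk L y z)) \<and>
     (\<forall>x\<in>carr L. \<forall>y\<in>carr L. \<forall>z\<in>carr L. brk L x (pls L y z) = pls L (brk L x y) (brk L x z)) \<and>
     (\<forall>a. \<forall>x\<in>carr L. \<forall>y\<in>carr L. brk L (scl L a x) y = scl L a (brk L x y)) \<and>
     (\<forall>a. \<forall>x\<in>carr L. \<forall>y\<in>carr L. brk L x (scl L a y) = scl L a (brk L x y)) \<and>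
     (\<forall>x\<in>carr L. brk L x x = zer L) \<and>
     (\<forall>x\<in>carr L. \<forall>y\<in>carr L. \<forall>z\<in>carr L.
        pls L (pls L (brk L x (brk L y z)) (brk L y (brk L z x))) (brk L z (brk L x y)) = zer L)"

definition subspace :: "('a, 'b) lie_scheme \<Rightarrow> 'a set \<Rightarrow> bool" where
  "subspace L W \<longleftrightarrow> W \<subseteq> carr L \<and> zer L \<in> W \<and>
     (\<forall>x\<in>W. \<forall>y\<in>W. pls L x y \<in> W) \<and> (\<forall>a. \<forall>x\<in>W. scl L a x \<in> W)"

definition lspan :: "('a, 'b) lie_scheme \<Rightarrow> 'a set \<Rightarrow> 'a set" where
  "lspan L S = \<Inter>{W. subspace L W \<and> S \<subseteq> W}"

definition subalgebra :: "('a, 'b) lie_scheme \<Rightarrow> 'a set \<Rightarrow> bool" where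
  "subalgebra L W \<longleftrightarrow> subspace L W \<and> (\<forall>x\<in>W. \<forall>y\<in>W. brk L x y \<in> W)"

definition lie_ideal :: "('a, 'b) lie_scheme \<Rightarrow> 'a set \<Rightarrow> bool" where
  "lie_ideal L I \<longleftrightarrow> subspace L I \<and> (\<forall>x\<in>carr L. \<forall>y\<in>I. brk L x y \<in> I)"

definition lie_gen :: "('a, 'b) lie_scheme \<Rightarrow> 'a set \<Rightarrow> 'a set" where
  "lie_gen L S = \<Inter>{W. subalgebra L W \<and> S \<subseteq> W}"

definition ideal_gen :: "('a, 'b) lie_scheme \<Rightarrow> 'a set \<Rightarrow> 'a set" where
  "ideal_gen L S = \<Inter>{I. lie_ideal L I \<and> S \<subseteq> I}"

definition fin_dim :: "('a, 'b) lie_scheme \<Rightarrow> bool" where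
  "fin_dim L \<longleftrightarrow> (\<exists>F. finite F \<and> F \<subseteq> carr L \<and> lspan L F = carr L)"

fun derived :: "('a, 'b) lie_scheme \<Rightarrow> 'a set \<Rightarrow> nat \<Rightarrow> 'a set" where
  "derived L I 0 = I"
| "derived L I (Suc k) = lspan L {brk L x y | x y. x \<in> derived L I k \<and> y \<in> derived L I k}"

definition solvable_ideal :: "('a, 'b) lie_scheme \<Rightarrow> 'a set \<Rightarrow> bool" where
  "solvable_ideal L I \<longleftrightarrow> lie_ideal L I \<and> (\<exists>k. derived L I k = {zer L})"

definition semisimple :: "('a, 'b) lie_scheme \<Rightarrow> bool" where
  "semisimple L \<longleftrightarrow> lie_algebra L \<and> fin_dim L \<and>
     (\<forall>I. solvable_ideal L I \<longrightarrow> I = {zer L})"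

definition lie_iso :: "('a, 'c) lie_scheme \<Rightarrow> ('b, 'd) lie_scheme \<Rightarrow> ('a \<Rightarrow> 'b) \<Rightarrow> bool" where
  "lie_iso L1 L2 \<phi> \<longleftrightarrow> bij_betw \<phi> (carr L1) (carr L2) \<and>
     (\<forall>x\<in>carr L1. \<forall>y\<in>carr L1. \<phi> (pls L1 x y) = pls L2 (\<phi> x) (\<phi> y)) \<and>
     (\<forall>a. \<forall>x\<in>carr L1. \<phi> (scl L1 a x) = scl L2 a (\<phi> x)) \<and>
     (\<forall>x\<in>carr L1. \<forall>y\<in>carr L1. \<phi> (brk L1 x y) = brk L2 (\<phi> x) (\<phi> y))"

definition lie_isomorphic :: "('a, 'c) lie_scheme \<Rightarrow> ('b, 'd) lie_scheme \<Rightarrow> bool" where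
  "lie_isomorphic L1 L2 \<longleftrightarrow> (\<exists>\<phi>. lie_iso L1 L2 \<phi>)"

definition coset :: "('a, 'b) lie_scheme \<Rightarrow> 'a set \<Rightarrow> 'a \<Rightarrow> 'a set" where
  "coset L I x = (\<lambda>i. pls L x i) ` I"

definition rep :: "'a set \<Rightarrow> 'a" where
  "rep A = (SOME a. a \<in> A)"

definition quot :: "('a, 'b) lie_scheme \<Rightarrow> 'a set \<Rightarrow> 'a set lie" where
  "quot L I = \<lparr> carr = coset L I ` carr L,
                zer = coset L I (zer L),
                pls = (\<lambda>A B. coset L I (pls L (rep A) (rep B))),
                scl = (\<lambda>a A. coset L I (scl L a (rep A))),
                brk = (\<lambda>A B. coset L I (brk L (rep A) (rep B))) \<rparr>"

text \<open>Free associative algebra on letters (nat) over C: finitely supported functions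
  on words; the free Lie algebra is the Lie subalgebra (under the commutator)
  generated by the letters (standard realization, Witt's theorem).\<close>

definition amul :: "(nat list \<Rightarrow> complex) \<Rightarrow> (nat list \<Rightarrow> complex) \<Rightarrow> nat list \<Rightarrow> complex" where
  "amul p q w = (\<Sum>i\<le>length w. p (take i w) * q (drop i w))"

definition assoc_lie :: "(nat list \<Rightarrow> complex) lie" where
  "assoc_lie = \<lparr> carr = {p. finite {w. p w \<noteq> 0}},
                  zer = (\<lambda>w. 0),
                  pls = (\<lambda>p q w. p w + q w),
                  scl = (\<lambda>a p w. a * p w),
                  brk = (\<lambda>p q w. amul p q w - amul q p w) \<rparr>"

definition letter :: "nat \<Rightarrow> nat list \<Rightarrow> complex" where
  "letter j = (\<lambda>w. if w = [j] then 1 else 0)"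

definition gen_e :: "nat \<Rightarrow> nat \<Rightarrow> nat list \<Rightarrow> complex" where "gen_e n i = letter i"
definition gen_f :: "nat \<Rightarrow> nat \<Rightarrow> nat list \<Rightarrow> complex" where "gen_f n i = letter (n + i)"
definition gen_h :: "nat \<Rightarrow> nat \<Rightarrow> nat list \<Rightarrow> complex" where "gen_h n i = letter (2 * n + i)"

definition free_lie :: "nat \<Rightarrow> (nat list \<Rightarrow> complex) lie" where
  "free_lie n = assoc_lie \<lparr> carr := lie_gen assoc_lie
       ((\<lambda>i. gen_e n i) ` {1..n} \<union> (\<lambda>i. gen_f n i) ` {1..n} \<union> (\<lambda>i. gen_h n i) ` {1..n}) \<rparr>"

definition Mn :: "nat \<Rightarrow> nat \<Rightarrow> nat \<Rightarrow> int" where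
  "Mn n i j = (if i = j then 2
     else if j = i + 1 \<or> i = j + 1 then -1
     else if (i = 1 \<and> j = n) \<or> (i = n \<and> j = 1) then 1
     else 0)"

definition ad_pow :: "('a, 'b) lie_scheme \<Rightarrow> 'a \<Rightarrow> nat \<Rightarrow> 'a \<Rightarrow> 'a" where
  "ad_pow L x k y = ((\<lambda>z. brk L x z) ^^ k) y"

definition gim_rels :: "nat \<Rightarrow> (nat list \<Rightarrow> complex) set" where
  "gim_rels n = (let F = free_lie n; e = gen_e n; f = gen_f n; h = gen_h n; m = Mn n in
     {lsub F (brk F (h i) (e j)) (scl F (of_int (m i j)) (e j)) | i j. i \<in> {1..n} \<and> j \<in> {1..n}}
   \<union> {lsub F (brk F (h i) (f j)) (scl F (- of_int (m i j)) (f j)) | i j. i \<in> {1..n} \<and> j \<in> {1..n}}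
   \<union> {lsub F (brk F (e i) (f i)) (h i) | i. i \<in> {1..n}}
   \<union> {r | r i j. i \<in> {1..n} \<and> j \<in> {1..n} \<and> i \<noteq> j \<and> m i j \<le> 0 \<and>
        (r = brk F (e i) (f j) \<or> r = brk F (f i) (e j) \<or>
         r = ad_pow F (e i) (nat (- m i j + 1)) (e j) \<or>
         r = ad_pow F (f i) (nat (- m i j + 1)) (f j))}
   \<union> {r | r i j. i \<in> {1..n} \<and> j \<in> {1..n} \<and> i \<noteq> j \<and> m i j > 0 \<and>
        (r = brk F (e i) (e j) \<or> r = brk F (f i) (f j) \<or>
         r = ad_pow F (e i) (nat (m i j + 1)) (f j) \<or>
         r = ad_pow F (f i) (nat (m i j + 1)) (e j))})"

definition gim :: "nat \<Rightarrow> (nat list \<Rightarrow> complex) set lie" where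
  "gim n = quot (free_lie n) (ideal_gen (free_lie n) (gim_rels n))"

definition mat_lie :: "nat \<Rightarrow> ((nat \<Rightarrow> nat \<Rightarrow> complex) \<Rightarrow> bool) \<Rightarrow> (nat \<Rightarrow> nat \<Rightarrow> complex) lie" where
  "mat_lie N P = \<lparr> carr = {X. (\<forall>i j. (N \<le> i \<or> N \<le> j) \<longrightarrow> X i j = 0) \<and> P X},
                   zer = (\<lambda>i j. 0),
                   pls = (\<lambda>X Y i j. X i j + Y i j),
                   scl = (\<lambda>a X i j. a * X i j),
                   brk = (\<lambda>X Y i j. (\<Sum>k<N. X i k * Y k j - Y i k * X k j)) \<rparr>"

definition sl_lie :: "nat \<Rightarrow> (nat \<Rightarrow> nat \<Rightarrow> complex) lie" where
  "sl_lie N = mat_lie N (\<lambda>X. (\<Sum>i<N. X i i) = 0)"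

text \<open>so_N: skew-symmetric matrices (form with Gram matrix the identity).\<close>
definition so_lie :: "nat \<Rightarrow> (nat \<Rightarrow> nat \<Rightarrow> complex) lie" where
  "so_lie N = mat_lie N (\<lambda>X. \<forall>i j. X j i = - X i j)"

definition Jmat :: "nat \<Rightarrow> nat \<Rightarrow> nat \<Rightarrow> complex" where
  "Jmat n i j = (if i < n \<and> j = i + n then 1 else if n \<le> i \<and> i < 2 * n \<and> i = j + n then -1 else 0)"

definition sp_lie :: "nat \<Rightarrow> (nat \<Rightarrow> nat \<Rightarrow> complex) lie" where
  "sp_lie n = mat_lie (2 * n) (\<lambda>X. \<forall>i<2 * n. \<forall>j<2 * n.
      (\<Sum>k<2 * n. X k i * Jmat n k j) + (\<Sum>k<2 * n. Jmat n i k * X k j) = 0)"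

definition dsum :: "'k set \<Rightarrow> ('k \<Rightarrow> 'a lie) \<Rightarrow> ('k \<Rightarrow> 'a) lie" where
  "dsum K Ls = \<lparr> carr = {x. (\<forall>k\<in>K. x k \<in> carr (Ls k)) \<and> (\<forall>k. k \<notin> K \<longrightarrow> x k = zer (Ls k))},
                 zer = (\<lambda>k. zer (Ls k)),
                 pls = (\<lambda>x y k. pls (Ls k) (x k) (y k)),
                 scl = (\<lambda>a x k. scl (Ls k) a (x k)),
                 brk = (\<lambda>x y k. brk (Ls k) (x k) (y k)) \<rparr>"

definition M_sum :: "nat \<Rightarrow> nat \<Rightarrow> nat \<Rightarrow> nat \<Rightarrow> (nat \<Rightarrow> nat \<Rightarrow> nat \<Rightarrow> complex) lie" where
  "M_sum n a c d = dsum {..<a + c + d}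
     (\<lambda>k. if k < a then sl_lie (2 * n) else if k < a + c then sp_lie n else so_lie (2 * n))"

definition of_type_M :: "nat \<Rightarrow> nat \<Rightarrow> nat \<Rightarrow> nat \<Rightarrow> ('a, 'b) lie_scheme \<Rightarrow> bool" where
  "of_type_M n a c d L \<longleftrightarrow> 3 \<le> n \<and> c \<le> 1 \<and> d \<le> 1 \<and>
     semisimple L \<and> carr L \<noteq> {zer L} \<and> lie_isomorphic L (M_sum n a c d)"

end

theory Submission
  imports Defs "HOL-Library.Function_Algebras"
begin

text \<open>
  Number the rows of \<open>2n \<times> 2n\<close> matrices by \<open>0, \<dots>, 2n - 1\<close> and let \<open>op\<close> be the
  involution \<open>a \<mapsto> a \<plusminus> n\<close>. For a parameter \<open>q \<noteq> 0\<close> the matrices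
  \<open>e\<^sub>i = E\<^bsub>i-1,i\<^esub> - E\<^bsub>op i, op (i-1)\<^esub>\<close> for \<open>i < n\<close>,
  \<open>e\<^sub>n = E\<^bsub>n-1,n\<^esub> + q E\<^bsub>op n, op (n-1)\<^esub>\<close>, and the \<open>f\<^sub>i\<close> obtained by transposing
  and inverting the coefficients, satisfy the relations of \<open>gim(M\<^sub>n)\<close>. They generate \<open>sp\<^bsub>2n\<^esub>\<close>
  if \<open>q = 1\<close>, the split form of \<open>so\<^bsub>2n\<^esub>\<close> if \<open>q = -1\<close>, and \<open>sl\<^bsub>2n\<^esub>\<close> otherwise.

  Take one parameter for each summand of the direct sum, no two of them equal or inverse to each
  other; this is possible because \<open>sp\<^bsub>2n\<^esub>\<close> and \<open>so\<^bsub>2n\<^esub>\<close> occur at most once. Brackets of the tuples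
  \<open>e\<^sub>i\<close>, \<open>f\<^sub>i\<close> produce, for each polynomial \<open>F\<close>, the tuples of
  \<open>F(-q) E\<^bsub>ij\<^esub> - F(-1/q) E\<^bsub>op j, op i\<^esub>\<close>, and interpolation isolates a single summand. Hence the
  tuples generate the whole direct sum, and the homomorphism theorem applies.
\<close>

section \<open>Quotients of Lie algebras\<close>

text \<open>Give a row \<open>a < n\<close> the weight eps_a and the row \<open>op n a\<close> the
  weight -eps_a. Then e_i has weight eps_(i-1) - eps_i for i < n, but e_n has weight eps_(n-1) +
  eps_0, since n is the opposite of 0. The inner products of these weights are the entries of the
  matrix; the entry 1 between the nodes 1 and n comes from the common +eps_0. Each such weight has
  multiplicity two in sl_2n, and q is the one coefficient that rescaling cannot remove, the holonomy
  around the cyclic diagram. The automorphism sending E_ab to -E_(op b, op a), followed by a torus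
  conjugation, carries the generators for q to those for 1/q. So two summands with equal or inverse
  parameters would yield only a diagonal copy, and at q = 1 or q = -1 the generators are confined to
  the fixed algebra of this automorphism. A further obstacle: the so_2n asked for consists of
  skew-symmetric matrices, while the generators live in the split form. Its block is conjugated by
  an explicit matrix after the evaluation.\<close>

locale lie =
  fixes L :: "('a, 'b) lie_scheme"
  assumes lie_algebra: "lie_algebra L"
begin

lemma closed [simp]:
  "zer L \<in> carr L"
  "x \<in> carr L \<Longrightarrow> y \<in> carr L \<Longrightarrow> pls L x y \<in> carr L"
  "x \<in> carr L \<Longrightarrow> scl L a x \<in> carr L"
  "x \<in> carr L \<Longrightarrow> y \<in> carr L \<Longrightarrow> brk L x y \<in> carr L"
  using lie_algebra unfolding lie_algebra_def by (elim conjE; meson)+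

lemma lsub_closed [simp]: "x \<in> carr L \<Longrightarrow> y \<in> carr L \<Longrightarrow> lsub L x y \<in> carr L"
  by (simp add: lsub_def)

lemma pls_assoc: "x \<in> carr L \<Longrightarrow> y \<in> carr L \<Longrightarrow> z \<in> carr L \<Longrightarrow>
    pls L (pls L x y) z = pls L x (pls L y z)"
  using lie_algebra unfolding lie_algebra_def by (elim conjE; meson)

lemma pls_commute: "x \<in> carr L \<Longrightarrow> y \<in> carr L \<Longrightarrow> pls L x y = pls L y x"
  using lie_algebra unfolding lie_algebra_def by (elim conjE; meson)

lemma pls_left_commute: "x \<in> carr L \<Longrightarrow> y \<in> carr L \<Longrightarrow> z \<in> carr L \<Longrightarrow>
    pls L x (pls L y z) = pls L y (pls L x z)"
  by (metis pls_assoc pls_commute)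

lemma pls_zer [simp]:
  "x \<in> carr L \<Longrightarrow> pls L (zer L) x = x" "x \<in> carr L \<Longrightarrow> pls L x (zer L) = x"
proof -
  show l: "x \<in> carr L \<Longrightarrow> pls L (zer L) x = x"
    using lie_algebra unfolding lie_algebra_def by (elim conjE; meson)
  then show "x \<in> carr L \<Longrightarrow> pls L x (zer L) = x"
    by (metis pls_commute closed(1))
qed

lemma pls_neg [simp]: "x \<in> carr L \<Longrightarrow> pls L x (scl L (-1) x) = zer L"
  using lie_algebra unfolding lie_algebra_def by (elim conjE; meson)

lemma scl_simps:
  "x \<in> carr L \<Longrightarrow> scl L 1 x = x"
  "x \<in> carr L \<Longrightarrow> scl L a (scl L b x) = scl L (a * b) x"
  "x \<in> carr L \<Longrightarrow> scl L (a + b) x = pls L (scl L a x) (scl L b x)"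
  "x \<in> carr L \<Longrightarrow> y \<in> carr L \<Longrightarrow> scl L a (pls L x y) = pls L (scl L a x) (scl L a y)"
  using lie_algebra unfolding lie_algebra_def by (elim conjE; meson)+

lemma brk_simps:
  "x \<in> carr L \<Longrightarrow> y \<in> carr L \<Longrightarrow> z \<in> carr L \<Longrightarrow>
    brk L (pls L x y) z = pls L (brk L x z) (brk L y z)"
  "x \<in> carr L \<Longrightarrow> y \<in> carr L \<Longrightarrow> z \<in> carr L \<Longrightarrow>
    brk L x (pls L y z) = pls L (brk L x y) (brk L x z)"
  "x \<in> carr L \<Longrightarrow> y \<in> carr L \<Longrightarrow> brk L (scl L a x) y = scl L a (brk L x y)"
  "x \<in> carr L \<Longrightarrow> y \<in> carr L \<Longrightarrow> brk L x (scl L a y) = scl L a (brk L x y)"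
  "x \<in> carr L \<Longrightarrow> brk L x x = zer L"
  using lie_algebra unfolding lie_algebra_def by (elim conjE; meson)+

lemma jacobi:
  "x \<in> carr L \<Longrightarrow> y \<in> carr L \<Longrightarrow> z \<in> carr L \<Longrightarrow>
    pls L (pls L (brk L x (brk L y z)) (brk L y (brk L z x))) (brk L z (brk L x y)) = zer L"
  using lie_algebra unfolding lie_algebra_def by (elim conjE; meson)

lemma neg_unique:
  assumes "x \<in> carr L" "y \<in> carr L" "pls L x y = zer L"
  shows "y = scl L (-1) x"
proof -
  have "y = pls L (pls L (scl L (-1) x) x) y"
    using assms by (simp add: pls_commute[of "scl L (-1) x" x])
  also have "\<dots> = scl L (-1) x"
    using assms by (simp add: pls_assoc)
  finally show ?thesis .
qed

lemma scl_zer [simp]: "scl L a (zer L) = zer L"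
proof -
  have "scl L a (zer L) = scl L a (pls L (zer L) (scl L (-1) (zer L)))"
    by simp
  also have "\<dots> = pls L (scl L a (zer L)) (scl L (-1) (scl L a (zer L)))"
    by (simp add: scl_simps(2,4) mult.commute del: pls_neg pls_zer)
  also have "\<dots> = zer L" by simp
  finally show ?thesis .
qed

lemma brk_zer [simp]: "x \<in> carr L \<Longrightarrow> brk L x (zer L) = zer L"
  using brk_simps(4)[of x "zer L" "-1"] brk_simps(2)[of x "zer L" "scl L (-1) (zer L)"]
  by (metis closed(1,3,4) pls_neg scl_zer)

lemma brk_anticommute:
  assumes "x \<in> carr L" "y \<in> carr L"
  shows "brk L y x = scl L (-1) (brk L x y)"
proof (rule neg_unique)
  have "zer L = brk L (pls L x y) (pls L x y)"
    using assms by (simp add: brk_simps(5))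
  also have "\<dots> = pls L (brk L x (pls L x y)) (brk L y (pls L x y))"
    using assms by (simp add: brk_simps(1))
  also have "\<dots> = pls L (brk L x y) (brk L y x)"
    using assms by (simp add: brk_simps(2) brk_simps(5))
  finally show "pls L (brk L x y) (brk L y x) = zer L" ..
qed (use assms in auto)

lemma lie_algebra_subalgebra:
  assumes "subalgebra L W"
  shows "lie_algebra (L\<lparr>carr := W\<rparr>)"
proof -
  have W: "\<And>x. x \<in> W \<Longrightarrow> x \<in> carr L"
    using assms unfolding subalgebra_def subspace_def by blast
  then have "x \<in> W \<Longrightarrow> pls L x (scl L (-1) x) = zer L" for x
    by simp
  with W show ?thesis
    using assms jacobi unfolding lie_algebra_def subalgebra_def subspace_def
    by (simp add: scl_simps(1,2) scl_simps(3) scl_simps(4) brk_simps pls_assoc pls_commute pls_left_commute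
        del: pls_neg)
qed

lemma lie_ideal_Inter:
  assumes "\<I> \<noteq> {}" "\<And>I. I \<in> \<I> \<Longrightarrow> lie_ideal L I"
  shows "lie_ideal L (\<Inter>\<I>)"
  using assms unfolding lie_ideal_def subspace_def by blast

lemma subalgebra_carr: "subalgebra L (carr L)"
  unfolding subalgebra_def subspace_def by simp

lemma subalgebra_lie_gen:
  assumes "S \<subseteq> carr L"
  shows "subalgebra L (lie_gen L S)"
proof -
  have "carr L \<in> {W. subalgebra L W \<and> S \<subseteq> W}"
    using assms subalgebra_carr by simp
  then show ?thesis
    unfolding lie_gen_def subalgebra_def subspace_def by (simp; blast)
qed

end

lemma lie_gen_superset: "S \<subseteq> lie_gen L S"
  unfolding lie_gen_def by blast

lemma lie_gen_least: "subalgebra L W \<Longrightarrow> S \<subseteq> W \<Longrightarrow> lie_gen L S \<subseteq> W"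
  unfolding lie_gen_def by blast

locale lie_ideal_pair = lie +
  fixes I :: "'a set"
  assumes ideal: "lie_ideal L I"
begin

lemma ideal_carr [simp]: "i \<in> I \<Longrightarrow> i \<in> carr L"
  using ideal unfolding lie_ideal_def subspace_def by blast

lemma ideal_closed [simp]:
  "zer L \<in> I"
  "i \<in> I \<Longrightarrow> j \<in> I \<Longrightarrow> pls L i j \<in> I"
  "i \<in> I \<Longrightarrow> scl L a i \<in> I"
  "x \<in> carr L \<Longrightarrow> i \<in> I \<Longrightarrow> brk L x i \<in> I"
  using ideal unfolding lie_ideal_def subspace_def by blast+

lemma ideal_brk_left [simp]: "x \<in> carr L \<Longrightarrow> i \<in> I \<Longrightarrow> brk L i x \<in> I"
  by (subst brk_anticommute) auto

lemma coset_absorb: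
  assumes "x \<in> carr L" "i \<in> I"
  shows "coset L I (pls L x i) = coset L I x"
proof
  show "coset L I (pls L x i) \<subseteq> coset L I x"
    unfolding coset_def using assms by (auto simp: pls_assoc)
  show "coset L I x \<subseteq> coset L I (pls L x i)"
  proof
    fix y assume "y \<in> coset L I x"
    then obtain j where j: "j \<in> I" "y = pls L x j"
      unfolding coset_def by blast
    have "pls L (pls L x i) (pls L (scl L (-1) i) j) = pls L x (pls L (pls L i (scl L (-1) i)) j)"
      using assms j by (simp add: pls_assoc del: pls_neg)
    also have "\<dots> = y"
      using assms j by simp
    finally have "y = pls L (pls L x i) (pls L (scl L (-1) i) j)" ..
    then show "y \<in> coset L I (pls L x i)"
      unfolding coset_def by (rule image_eqI) (use assms j in simp)
  qed
qed

text \<open>The operations of \<open>quot\<close> act on representatives chosen by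
  \<open>SOME\<close>. The chosen one differs from \<open>x\<close> by an element of the ideal, so
  each well-definedness proof collects the error terms and lets \<open>coset_absorb\<close> swallow
  them.\<close>

lemma rep_coset:
  assumes "x \<in> carr L"
  obtains i where "i \<in> I" "rep (coset L I x) = pls L x i"
proof -
  have "pls L x (zer L) \<in> coset L I x"
    unfolding coset_def by (rule imageI) simp
  then have "rep (coset L I x) \<in> coset L I x"
    unfolding rep_def by (rule someI)
  then show ?thesis
    using that unfolding coset_def by blast
qed

lemma coset_eqI:
  assumes "x \<in> carr L" "y \<in> carr L" "lsub L x y \<in> I"
  shows "coset L I x = coset L I y"
proof -
  have "pls L y (lsub L x y) = pls L x (pls L y (scl L (-1) y))"
    using assms unfolding lsub_def by (simp add: pls_left_commute del: pls_neg)
  then show ?thesis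
    using coset_absorb[of y "lsub L x y"] assms by simp
qed

lemma quot_pls:
  assumes "x \<in> carr L" "y \<in> carr L"
  shows "pls (quot L I) (coset L I x) (coset L I y) = coset L I (pls L x y)"
proof -
  obtain i where i: "i \<in> I" "rep (coset L I x) = pls L x i" by (rule rep_coset[OF assms(1)])
  obtain j where j: "j \<in> I" "rep (coset L I y) = pls L y j" by (rule rep_coset[OF assms(2)])
  have "pls L (pls L x i) (pls L y j) = pls L (pls L x y) (pls L i j)"
    using assms i(1) j(1) by (simp add: pls_assoc pls_left_commute)
  then show ?thesis
    using coset_absorb[of "pls L x y" "pls L i j"] assms i j by (simp add: quot_def)
qed

lemma quot_scl:
  assumes "x \<in> carr L"
  shows "scl (quot L I) a (coset L I x) = coset L I (scl L a x)"
proof -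
  obtain i where i: "i \<in> I" "rep (coset L I x) = pls L x i" by (rule rep_coset[OF assms(1)])
  then show ?thesis
    using coset_absorb[of "scl L a x" "scl L a i"] assms by (simp add: quot_def scl_simps)
qed

lemma quot_brk:
  assumes "x \<in> carr L" "y \<in> carr L"
  shows "brk (quot L I) (coset L I x) (coset L I y) = coset L I (brk L x y)"
proof -
  obtain i where i: "i \<in> I" "rep (coset L I x) = pls L x i" by (rule rep_coset[OF assms(1)])
  obtain j where j: "j \<in> I" "rep (coset L I y) = pls L y j" by (rule rep_coset[OF assms(2)])
  have "brk L (pls L x i) (pls L y j) =
      pls L (brk L x y) (pls L (brk L x j) (pls L (brk L i y) (brk L i j)))"
    using assms i(1) j(1) by (simp add: brk_simps pls_assoc pls_left_commute)
  then show ?thesis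
    using coset_absorb[of "brk L x y" "pls L (brk L x j) (pls L (brk L i y) (brk L i j))"] assms i j
    by (simp add: quot_def)
qed

lemma carr_quot: "carr (quot L I) = coset L I ` carr L"
  by (simp add: quot_def)

lemma zer_quot: "zer (quot L I) = coset L I (zer L)"
  by (simp add: quot_def)

lemma lie_algebra_quot: "lie_algebra (quot L I)"
  unfolding lie_algebra_def carr_quot zer_quot
  by (simp add: quot_pls quot_scl quot_brk scl_simps(1,2) scl_simps(3) scl_simps(4) brk_simps
      jacobi pls_assoc pls_commute pls_left_commute)
    (metis closed(4) jacobi pls_assoc)

end

section \<open>Epimorphisms, kernels and the homomorphism theorem\<close>

definition lie_epi :: "('a, 'c) lie_scheme \<Rightarrow> ('b, 'd) lie_scheme \<Rightarrow> ('a \<Rightarrow> 'b) \<Rightarrow> bool" where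
  "lie_epi L M f \<longleftrightarrow> f ` carr L = carr M \<and>
     (\<forall>x\<in>carr L. \<forall>y\<in>carr L. f (pls L x y) = pls M (f x) (f y)) \<and>
     (\<forall>a. \<forall>x\<in>carr L. f (scl L a x) = scl M a (f x)) \<and>
     (\<forall>x\<in>carr L. \<forall>y\<in>carr L. f (brk L x y) = brk M (f x) (f y))"

text \<open>Values are compared with the image of zero instead of \<open>zer M\<close>:
  \<open>lie_epi\<close> does not mention zero, and the codomain is a bare record without
  laws.\<close>

definition lie_kernel :: "('a, 'c) lie_scheme \<Rightarrow> ('a \<Rightarrow> 'b) \<Rightarrow> 'a set" where
  "lie_kernel L f = {x \<in> carr L. f x = f (zer L)}"

context lie
begin

text \<open>In place of laws in the codomain, the kernel arguments are replaced by zero under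
  \<open>f\<close>: the images of \<open>x + y\<close> and of \<open>0 + 0\<close> are the same sum
  in \<open>M\<close>, and the latter is evaluated in \<open>L\<close>.\<close>

lemma lie_ideal_kernel:
  assumes "lie_epi L M f"
  shows "lie_ideal L (lie_kernel L f)"
proof -
  have "f (pls L x y) = f (pls L (zer L) (zer L))" if "x \<in> lie_kernel L f" "y \<in> lie_kernel L f" for x y
    using assms that unfolding lie_epi_def lie_kernel_def by (simp del: pls_zer)
  moreover have "f (scl L a x) = f (scl L a (zer L))" if "x \<in> lie_kernel L f" for a x
    using assms that unfolding lie_epi_def lie_kernel_def by (simp del: scl_zer)
  moreover have "f (brk L x y) = f (brk L x (zer L))" if "x \<in> carr L" "y \<in> lie_kernel L f" for x y
    using assms that unfolding lie_epi_def lie_kernel_def by (simp del: brk_zer)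
  ultimately show ?thesis
    unfolding lie_ideal_def subspace_def by (auto simp: lie_kernel_def)
qed

lemma epi_rep_coset:
  assumes f: "lie_epi L M f" and I: "lie_ideal L I" "I \<subseteq> lie_kernel L f" and x: "x \<in> carr L"
  shows "f (rep (coset L I x)) = f x"
proof -
  interpret lie_ideal_pair L I
    using I by unfold_locales
  obtain i where i: "i \<in> I" "rep (coset L I x) = pls L x i" by (rule rep_coset[OF x])
  then have "f (pls L x i) = f (pls L x (zer L))"
    using f x I(2) unfolding lie_epi_def lie_kernel_def by (auto simp del: pls_zer)
  then show ?thesis
    using i x by simp
qed

lemma lie_epi_quot:
  assumes f: "lie_epi L M f" and I: "lie_ideal L I" "I \<subseteq> lie_kernel L f"
  shows "lie_epi (quot L I) M (\<lambda>A. f (rep A))"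
proof -
  interpret lie_ideal_pair L I
    using I by unfold_locales
  show ?thesis
    using f unfolding lie_epi_def carr_quot
    by (auto simp: quot_pls quot_scl quot_brk epi_rep_coset[OF f I] image_image cong: image_cong)
qed

theorem first_isomorphism:
  assumes f: "lie_epi L M f"
  shows "lie_isomorphic (quot L (lie_kernel L f)) M"
proof -
  let ?I = "lie_kernel L f"
  have I: "lie_ideal L ?I" using f by (rule lie_ideal_kernel)
  interpret lie_ideal_pair L ?I
    using I by unfold_locales
  have "lie_epi (quot L ?I) M (\<lambda>A. f (rep A))"
    using lie_epi_quot[OF f I] by simp
  moreover have "inj_on (\<lambda>A. f (rep A)) (carr (quot L ?I))"
  proof (rule inj_onI)
    fix A B assume "A \<in> carr (quot L ?I)" "B \<in> carr (quot L ?I)" and eq: "f (rep A) = f (rep B)"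
    then obtain x y where xy: "x \<in> carr L" "y \<in> carr L" and A: "A = coset L ?I x" and B: "B = coset L ?I y"
      unfolding carr_quot by blast
    have fxy: "f x = f y"
      using eq xy epi_rep_coset[OF f I] unfolding A B by simp
    have "f (lsub L x y) = pls M (f y) (scl M (-1) (f y))"
      using f xy fxy unfolding lie_epi_def lsub_def by simp
    also have "\<dots> = f (pls L y (scl L (-1) y))"
      using f xy unfolding lie_epi_def by (simp del: pls_neg)
    finally have "lsub L x y \<in> ?I"
      using xy unfolding lie_kernel_def by simp
    then show "A = B"
      using coset_eqI xy unfolding A B by blast
  qed
  ultimately show ?thesis
    unfolding lie_isomorphic_def lie_iso_def lie_epi_def bij_betw_def by blast
qed

text \<open>\<open>gim n\<close> is itself a quotient of a free Lie algebra, so the epimorphism is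
  pushed down to \<open>quot L I\<close>; the ideal sought is the kernel of the induced map.\<close>

lemma quot_quot_isomorphic:
  assumes f: "lie_epi L M f" and I: "lie_ideal L I" "I \<subseteq> lie_kernel L f"
  shows "\<exists>J. lie_ideal (quot L I) J \<and> lie_isomorphic (quot (quot L I) J) M"
proof -
  interpret lie_ideal_pair L I
    using I by unfold_locales
  interpret Q: lie "quot L I"
    using lie_algebra_quot by unfold_locales
  show ?thesis
    using Q.lie_ideal_kernel[OF lie_epi_quot[OF assms]] Q.first_isomorphism[OF lie_epi_quot[OF assms]]
    by blast
qed

end

text \<open>The given isomorphism runs from \<open>L\<close> to the concrete direct sum, but the
  quotient has to be isomorphic to \<open>L\<close>; composing with the inverse transfers the
  epimorphism.\<close>

lemma lie_epi_inverse_iso: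
  assumes f: "lie_epi F M f" and L: "lie_algebra L" and i: "lie_iso L M \<phi>"
  shows "lie_epi F L (\<lambda>x. inv_into (carr L) \<phi> (f x))"
proof -
  interpret lie L using L by unfold_locales
  let ?g = "inv_into (carr L) \<phi>"
  have bij: "bij_betw \<phi> (carr L) (carr M)"
    using i unfolding lie_iso_def by blast
  have g: "?g y \<in> carr L" "\<phi> (?g y) = y" if "y \<in> carr M" for y
    using that bij by (auto simp: bij_betw_def inv_into_into f_inv_into_f)
  have gI: "?g y = x" if "x \<in> carr L" "y = \<phi> x" for x y
    using that bij by (simp add: bij_betw_def)
  have fM: "f x \<in> carr M" if "x \<in> carr F" for x
    using f that unfolding lie_epi_def by blast
  have "(\<lambda>x. ?g (f x)) ` carr F = ?g ` carr M"
    using f unfolding lie_epi_def by (metis image_image)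
  moreover have "?g ` carr M = carr L"
    using bij by (metis bij_betw_def bij_betw_inv_into)
  ultimately show ?thesis
    using f i fM g unfolding lie_epi_def lie_iso_def by (auto intro!: gI)
qed

section \<open>The free associative algebra\<close>

lemma amul_Nil: "amul p q [] = p [] * q []"
  by (simp add: amul_def)

text \<open>Peeling the first letter off the argument replaces \<open>p\<close> by its left shift.
  Associativity then follows by induction on the word with \<open>p\<close> arbitrary, with no
  double sums to rearrange.\<close>

lemma amul_Cons: "amul p q (x # w) = p [] * q (x # w) + amul (\<lambda>u. p (x # u)) q w"
  unfolding amul_def length_Cons by (subst sum.atMost_Suc_shift) simp

lemma amul_linear:
  "amul (\<lambda>u. p u + p' u) q w = amul p q w + amul p' q w"
  "amul p (\<lambda>u. q u + q' u) w = amul p q w + amul p q' w"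
  "amul (\<lambda>u. p u - p' u) q w = amul p q w - amul p' q w"
  "amul p (\<lambda>u. q u - q' u) w = amul p q w - amul p q' w"
  "amul (\<lambda>u. a * p u) q w = a * amul p q w"
  "amul p (\<lambda>u. a * q u) w = a * amul p q w"
  unfolding amul_def by (simp_all add: algebra_simps sum.distrib sum_subtractf sum_distrib_left)

lemma amul_assoc: "amul (amul p q) r w = amul p (amul q r) w"
proof (induction w arbitrary: p)
  case Nil
  then show ?case by (simp add: amul_Nil)
next
  case (Cons x w)
  have "amul (\<lambda>u. amul p q (x # u)) r w =
      p [] * amul (\<lambda>u. q (x # u)) r w + amul (\<lambda>u. p (x # u)) (amul q r) w"
    by (simp add: amul_Cons amul_linear Cons)
  then show ?case
    by (simp add: amul_Cons amul_Nil algebra_simps)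
qed

definition asupp :: "(nat list \<Rightarrow> complex) \<Rightarrow> nat list set" where
  "asupp p = {w. p w \<noteq> 0}"

lemma amul_conv_sum:
  assumes A: "finite A" "asupp p \<subseteq> A" and B: "finite B" "asupp q \<subseteq> B"
  shows "amul p q w = (\<Sum>(u, v)\<in>{(u, v) \<in> A \<times> B. u @ v = w}. p u * q v)"
proof -
  let ?f = "\<lambda>i. (take i w, drop i w)"
  have inj: "inj_on ?f {..length w}"
  proof (rule inj_onI)
    fix i j assume "i \<in> {..length w}" "j \<in> {..length w}" "?f i = ?f j"
    then show "i = j"
      by (metis (no_types, lifting) atMost_iff length_take min.absorb2 prod.inject)
  qed
  have im: "(u, v) \<in> ?f ` {..length w}" if "u @ v = w" for u v
    using that by (intro image_eqI[of _ _ "length u"]) auto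
  have "amul p q w = (\<Sum>(u, v)\<in>?f ` {..length w}. p u * q v)"
    unfolding amul_def by (subst sum.reindex[OF inj]) simp
  also have "\<dots> = (\<Sum>(u, v)\<in>{(u, v) \<in> A \<times> B. u @ v = w}. p u * q v)"
  proof (rule sum.mono_neutral_right)
    show "{(u, v) \<in> A \<times> B. u @ v = w} \<subseteq> ?f ` {..length w}"
      using im by auto
    show "\<forall>i\<in>?f ` {..length w} - {(u, v) \<in> A \<times> B. u @ v = w}. (case i of (u, v) \<Rightarrow> p u * q v) = 0"
      using A B by (auto simp: asupp_def)
  qed simp
  finally show ?thesis .
qed

lemma asupp_amul: "asupp (amul p q) \<subseteq> (\<lambda>(u, v). u @ v) ` (asupp p \<times> asupp q)"
proof
  fix w assume "w \<in> asupp (amul p q)"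
  then have "(\<Sum>i\<le>length w. p (take i w) * q (drop i w)) \<noteq> 0"
    unfolding asupp_def amul_def by simp
  then obtain i where "p (take i w) * q (drop i w) \<noteq> 0"
    by (meson sum.not_neutral_contains_not_neutral)
  then have "(take i w, drop i w) \<in> asupp p \<times> asupp q"
    by (simp add: asupp_def)
  then show "w \<in> (\<lambda>(u, v). u @ v) ` (asupp p \<times> asupp q)"
    by (rule rev_image_eqI) simp
qed

lemma finite_asupp_amul: "finite (asupp p) \<Longrightarrow> finite (asupp q) \<Longrightarrow> finite (asupp (amul p q))"
  by (rule finite_subset[OF asupp_amul]) simp

lemma assoc_lie_sel:
  "carr assoc_lie = {p. finite (asupp p)}"
  "zer assoc_lie = (\<lambda>w. 0)"
  "pls assoc_lie p q = (\<lambda>w. p w + q w)"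
  "scl assoc_lie a p = (\<lambda>w. a * p w)"
  "brk assoc_lie p q = (\<lambda>w. amul p q w - amul q p w)"
  by (simp_all add: assoc_lie_def asupp_def)

lemma finite_asupp_plus: "finite (asupp p) \<Longrightarrow> finite (asupp q) \<Longrightarrow> finite (asupp (\<lambda>w. p w + q w))"
  by (rule finite_subset[of _ "asupp p \<union> asupp q"]) (auto simp: asupp_def)

lemma finite_asupp_minus: "finite (asupp p) \<Longrightarrow> finite (asupp q) \<Longrightarrow> finite (asupp (\<lambda>w. p w - q w))"
  by (rule finite_subset[of _ "asupp p \<union> asupp q"]) (auto simp: asupp_def)

lemma finite_asupp_scale: "finite (asupp p) \<Longrightarrow> finite (asupp (\<lambda>w. a * p w))"
  by (rule finite_subset[of _ "asupp p"]) (auto simp: asupp_def)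

lemma lie_algebra_assoc_lie: "lie_algebra assoc_lie"
proof -
  have "finite (asupp (\<lambda>w. 0))"
    by (simp add: asupp_def)
  then show ?thesis
    unfolding lie_algebra_def assoc_lie_sel
    by (simp add: finite_asupp_plus finite_asupp_minus finite_asupp_scale finite_asupp_amul
        amul_linear amul_assoc algebra_simps)
qed

interpretation assoc: lie assoc_lie
  by unfold_locales (rule lie_algebra_assoc_lie)

lemma finite_asupp_letter: "finite (asupp (letter j))"
  by (rule finite_subset[of _ "{[j]}"]) (auto simp: asupp_def letter_def)

definition gim_gens :: "nat \<Rightarrow> (nat list \<Rightarrow> complex) set" where
  "gim_gens n = gen_e n ` {1..n} \<union> gen_f n ` {1..n} \<union> gen_h n ` {1..n}"

lemma gim_gens_carr: "gim_gens n \<subseteq> carr assoc_lie"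
  by (auto simp: gim_gens_def gen_e_def gen_f_def gen_h_def assoc_lie_sel finite_asupp_letter)

lemma free_lie_eq: "free_lie n = assoc_lie\<lparr>carr := lie_gen assoc_lie (gim_gens n)\<rparr>"
  by (simp add: free_lie_def gim_gens_def)

lemma lie_algebra_free_lie: "lie_algebra (free_lie n)"
  unfolding free_lie_eq
  by (intro assoc.lie_algebra_subalgebra assoc.subalgebra_lie_gen gim_gens_carr)

lemma free_lie_carr: "carr (free_lie n) \<subseteq> {p. finite (asupp p)}"
  unfolding free_lie_eq using lie_gen_least[OF assoc.subalgebra_carr gim_gens_carr]
  by (simp add: assoc_lie_sel)

lemma free_lie_sel:
  "zer (free_lie n) = (\<lambda>w. 0)"
  "pls (free_lie n) p q = (\<lambda>w. p w + q w)"
  "scl (free_lie n) a p = (\<lambda>w. a * p w)"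
  "brk (free_lie n) p q = (\<lambda>w. amul p q w - amul q p w)"
  by (simp_all add: free_lie_eq assoc_lie_sel)

lemma gens_free_lie:
  assumes "i \<in> {1..n}"
  shows "gen_e n i \<in> carr (free_lie n)" "gen_f n i \<in> carr (free_lie n)" "gen_h n i \<in> carr (free_lie n)"
proof -
  have "gim_gens n \<subseteq> carr (free_lie n)"
    by (simp add: free_lie_eq lie_gen_superset)
  then show "gen_e n i \<in> carr (free_lie n)" "gen_f n i \<in> carr (free_lie n)" "gen_h n i \<in> carr (free_lie n)"
    using assms unfolding gim_gens_def by blast+
qed

section \<open>Tuples of matrices\<close>

type_synonym tup = "nat \<Rightarrow> nat \<Rightarrow> nat \<Rightarrow> complex"

definition tmul :: "nat \<Rightarrow> tup \<Rightarrow> tup \<Rightarrow> tup" where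
  "tmul N x y = (\<lambda>k i j. \<Sum>l<N. x k i l * y k l j)"

definition tbr :: "nat \<Rightarrow> tup \<Rightarrow> tup \<Rightarrow> tup" where
  "tbr N x y = tmul N x y - tmul N y x"

definition tscale :: "complex \<Rightarrow> tup \<Rightarrow> tup" where
  "tscale a x = (\<lambda>k i j. a * x k i j)"

lemma tmul_linear:
  "tmul N (x + x') y = tmul N x y + tmul N x' y"
  "tmul N x (y + y') = tmul N x y + tmul N x y'"
  "tmul N (x - x') y = tmul N x y - tmul N x' y"
  "tmul N x (y - y') = tmul N x y - tmul N x y'"
  "tmul N (- x) y = - tmul N x y"
  "tmul N x (- y) = - tmul N x y"
  "tmul N (tscale a x) y = tscale a (tmul N x y)"
  "tmul N x (tscale a y) = tscale a (tmul N x y)"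
  "tmul N 0 y = 0"
  "tmul N x 0 = 0"
  unfolding tmul_def tscale_def
  by (simp_all add: fun_eq_iff algebra_simps sum.distrib sum_subtractf sum_distrib_left sum_negf)

lemma tmul_assoc: "tmul N (tmul N x y) z = tmul N x (tmul N y z)"
proof -
  have "(\<Sum>l<N. (\<Sum>m<N. x k i m * y k m l) * z k l j) = (\<Sum>m<N. x k i m * (\<Sum>l<N. y k m l * z k l j))"
    for k i j
    by (simp add: sum_distrib_left sum_distrib_right mult.assoc) (rule sum.swap)
  then show ?thesis
    by (simp add: tmul_def)
qed

lemma tscale_simps:
  "tscale a (x + y) = tscale a x + tscale a y"
  "tscale a (x - y) = tscale a x - tscale a y"
  "tscale a (- x) = - tscale a x"
  "tscale a 0 = 0"
  "tscale 1 x = x"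
  "tscale (-1) x = - x"
  "tscale a (tscale b x) = tscale (a * b) x"
  by (auto simp: tscale_def fun_eq_iff algebra_simps)

section \<open>Evaluation of noncommutative polynomials at tuples of matrices\<close>

fun word_eval :: "nat \<Rightarrow> (nat \<Rightarrow> tup) \<Rightarrow> nat list \<Rightarrow> tup" where
  "word_eval N g [] = (\<lambda>k i j. if i = j \<and> i < N then 1 else 0)"
| "word_eval N g (x # w) = tmul N (g x) (word_eval N g w)"

definition row_bounded :: "nat \<Rightarrow> tup \<Rightarrow> bool" where
  "row_bounded N x \<longleftrightarrow> (\<forall>k i j. N \<le> i \<longrightarrow> x k i j = 0)"

lemma row_bounded_word_eval:
  assumes "\<And>x. row_bounded N (g x)"
  shows "row_bounded N (word_eval N g w)"
  using assms by (cases w) (auto simp: row_bounded_def tmul_def)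

text \<open>The empty word goes to the identity cut off at \<open>N\<close>, the unit of a product
  that sums over \<open>l < N\<close>. It reproduces a factor only if that factor has no entries in
  rows from \<open>N\<close> on.\<close>

lemma word_eval_append:
  assumes "\<And>x. row_bounded N (g x)"
  shows "word_eval N g (u @ v) = tmul N (word_eval N g u) (word_eval N g v)"
proof (induction u)
  case Nil
  have "(\<Sum>l<N. (if i = l \<and> i < N then 1 else 0) * word_eval N g v k l j) = word_eval N g v k i j" for k i j
  proof (cases "i < N")
    case True
    then have "(\<Sum>l<N. (if i = l \<and> i < N then 1 else 0) * word_eval N g v k l j) =
        (\<Sum>l<N. if i = l then word_eval N g v k l j else 0)"
      by (intro sum.cong) auto
    then show ?thesis
      using True by simp
  next
    case False
    then show ?thesis
      using row_bounded_word_eval[of N g v] assms by (simp add: row_bounded_def)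
  qed
  then show ?case
    by (simp add: tmul_def fun_eq_iff)
next
  case (Cons x u)
  then show ?case
    by (simp add: tmul_assoc)
qed

definition eval :: "nat \<Rightarrow> (nat \<Rightarrow> tup) \<Rightarrow> (nat list \<Rightarrow> complex) \<Rightarrow> tup" where
  "eval N g p = (\<Sum>w\<in>asupp p. tscale (p w) (word_eval N g w))"

lemma eval_superset:
  assumes "finite A" "asupp p \<subseteq> A"
  shows "eval N g p = (\<Sum>w\<in>A. tscale (p w) (word_eval N g w))"
  unfolding eval_def
  by (rule sum.mono_neutral_left) (use assms in \<open>auto simp: asupp_def tscale_def fun_eq_iff\<close>)

lemma eval_plus:
  assumes "finite (asupp p)" "finite (asupp q)"
  shows "eval N g (\<lambda>w. p w + q w) = eval N g p + eval N g q"
proof -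
  let ?A = "asupp p \<union> asupp q"
  have *: "asupp (\<lambda>w. p w + q w) \<subseteq> ?A" "asupp p \<subseteq> ?A" "asupp q \<subseteq> ?A"
    by (auto simp: asupp_def)
  have "tscale (a + b) x = tscale a x + tscale b x" for a b x
    by (simp add: tscale_def fun_eq_iff algebra_simps)
  then show ?thesis
    using assms *[THEN eval_superset[rotated]] by (simp add: sum.distrib)
qed

lemma tscale_sum: "tscale a (\<Sum>w\<in>A. f w) = (\<Sum>w\<in>A. tscale a (f w))"
  by (rule sum_comp_morphism[of "tscale a" f A, unfolded o_def, symmetric]) (rule tscale_simps)+

lemma tscale_sum_left: "tscale (\<Sum>w\<in>A. f w) x = (\<Sum>w\<in>A. tscale (f w) x)"
  by (rule sum_comp_morphism[of "\<lambda>a. tscale a x" f A, unfolded o_def, symmetric])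
    (simp_all add: tscale_def fun_eq_iff algebra_simps)

lemma tmul_sum:
  "tmul N (\<Sum>w\<in>A. f w) y = (\<Sum>w\<in>A. tmul N (f w) y)"
  "tmul N y (\<Sum>w\<in>A. f w) = (\<Sum>w\<in>A. tmul N y (f w))"
  by (rule sum_comp_morphism[of "\<lambda>x. tmul N x y" f A, unfolded o_def, symmetric]; rule tmul_linear)
    (rule sum_comp_morphism[of "tmul N y" f A, unfolded o_def, symmetric]; rule tmul_linear)

lemma eval_scale:
  assumes "finite (asupp p)"
  shows "eval N g (\<lambda>w. a * p w) = tscale a (eval N g p)"
proof -
  have "asupp (\<lambda>w. a * p w) \<subseteq> asupp p"
    by (auto simp: asupp_def)
  from eval_superset[OF assms this, of N g] show ?thesis
    unfolding eval_def tscale_sum tscale_simps .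
qed

lemma eval_minus:
  assumes "finite (asupp p)" "finite (asupp q)"
  shows "eval N g (\<lambda>w. p w - q w) = eval N g p - eval N g q"
  using eval_plus[OF assms(1) finite_asupp_scale[OF assms(2), of "-1"], of N g]
  unfolding eval_scale[OF assms(2)] tscale_simps by simp

text \<open>Pairs of words are grouped by their concatenation: each group sums to a coefficient of
  \<open>amul p q\<close>, and the sum over all pairs is the expanded matrix product.\<close>

lemma eval_amul:
  assumes g: "\<And>x. row_bounded N (g x)" and p: "finite (asupp p)" and q: "finite (asupp q)"
  shows "eval N g (amul p q) = tmul N (eval N g p) (eval N g q)"
proof -
  let ?C = "asupp p \<times> asupp q" and ?W = "word_eval N g"
  have "eval N g (amul p q) =
      (\<Sum>w\<in>(\<lambda>(u, v). u @ v) ` ?C. tscale (amul p q w) (?W w))"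
    by (rule eval_superset) (use p q asupp_amul in auto)
  also have "\<dots> = (\<Sum>w\<in>(\<lambda>(u, v). u @ v) ` ?C.
      \<Sum>(u, v)\<in>{c \<in> ?C. (\<lambda>(u, v). u @ v) c = w}. tscale (p u * q v) (?W (u @ v)))"
  proof (rule sum.cong[OF refl])
    fix w
    have eq: "{(u, v) \<in> ?C. u @ v = w} = {c \<in> ?C. (\<lambda>(u, v). u @ v) c = w}"
      by auto
    have "tscale (amul p q w) (?W w) =
        (\<Sum>c\<in>{c \<in> ?C. (\<lambda>(u, v). u @ v) c = w}. tscale (case c of (u, v) \<Rightarrow> p u * q v) (?W w))"
      unfolding amul_conv_sum[OF p order_refl q order_refl] eq by (rule tscale_sum_left)
    also have "\<dots> = (\<Sum>(u, v)\<in>{c \<in> ?C. (\<lambda>(u, v). u @ v) c = w}. tscale (p u * q v) (?W (u @ v)))"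
      by (rule sum.cong) auto
    finally show "tscale (amul p q w) (?W w) =
        (\<Sum>(u, v)\<in>{c \<in> ?C. (\<lambda>(u, v). u @ v) c = w}. tscale (p u * q v) (?W (u @ v)))" .
  qed
  also have "\<dots> = (\<Sum>(u, v)\<in>?C. tscale (p u * q v) (?W (u @ v)))"
    by (rule sum.image_gen[symmetric]) (use p q in auto)
  also have "\<dots> = tmul N (eval N g p) (eval N g q)"
    unfolding eval_def tmul_sum(1) unfolding tmul_sum(2)
    by (simp only: sum.cartesian_product tmul_linear tscale_simps word_eval_append[OF g] mult.commute)
  finally show ?thesis .
qed

lemma eval_letter:
  assumes "\<And>k i j. N \<le> j \<Longrightarrow> g x k i j = 0"
  shows "eval N g (letter x) = g x"
proof -
  have "asupp (letter x) = {[x]}"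
    by (auto simp: asupp_def letter_def)
  moreover have "(\<Sum>l<N. g x k i l * (if l = j \<and> l < N then 1 else 0)) = g x k i j" for k i j
  proof (cases "j < N")
    case True
    then have "(\<Sum>l<N. g x k i l * (if l = j \<and> l < N then 1 else 0)) = (\<Sum>l<N. if j = l then g x k i l else 0)"
      by (intro sum.cong) auto
    then show ?thesis
      using True by simp
  qed (use assms in auto)
  ultimately show ?thesis
    by (simp add: eval_def letter_def tscale_simps tmul_def)
qed

section \<open>Root vectors and the defining relations\<close>

text \<open>The coefficient is a function of the summand index: a tuple of matrices is handled as
  one matrix over the ring of such functions.\<close>

definition E :: "(nat \<Rightarrow> complex) \<Rightarrow> nat \<Rightarrow> nat \<Rightarrow> tup" where
  "E g a b = (\<lambda>k i j. if i = a \<and> j = b then g k else 0)"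

lemma tmul_E:
  assumes "b < N"
  shows "tmul N (E g a b) (E h c d) = (if b = c then E (g * h) a d else 0)"
proof -
  have "(\<Sum>l<N. E g a b k i l * E h c d k l j) = (\<Sum>l<N. if b = l then (if b = c then E (g * h) a d k i j else 0) else 0)"
    for k i j
    by (intro sum.cong) (auto simp: E_def)
  then show ?thesis
    using assms by (simp add: tmul_def fun_eq_iff)
qed

lemma E_linear:
  "E (g + h) a b = E g a b + E h a b"
  "E (g - h) a b = E g a b - E h a b"
  "E (- g) a b = - E g a b"
  "E 0 a b = 0"
  "tscale c (E g a b) = E (\<lambda>k. c * g k) a b"
  by (auto simp: E_def fun_eq_iff tscale_def)

definition op :: "nat \<Rightarrow> nat \<Rightarrow> nat" where
  "op n a = (if a < n then a + n else a - n)"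

lemma op_simps [simp]:
  "a < 2 * n \<Longrightarrow> op n a < 2 * n"
  "a < 2 * n \<Longrightarrow> op n (op n a) = a"
  by (auto simp: op_def)

text \<open>The pairs for which the matrix unit has a weight +-eps_x +- eps_y with distinct x and y.
  Diagonal positions and the weights +-2 eps_x, from \<open>b = op n a\<close>, are left
  out.\<close>

definition indep :: "nat \<Rightarrow> nat \<Rightarrow> nat \<Rightarrow> bool" where
  "indep n a b \<longleftrightarrow> a < 2 * n \<and> b < 2 * n \<and> a \<noteq> b \<and> a \<noteq> op n b"

lemma indepD:
  assumes "indep n a b"
  shows "a < 2 * n" "b < 2 * n" "a \<noteq> b" "b \<noteq> a" "a \<noteq> op n b" "op n b \<noteq> a" "op n a \<noteq> b" "b \<noteq> op n a"
    "op n a \<noteq> op n b" "op n b \<noteq> op n a"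
  using assms unfolding indep_def op_def by (cases "a < n"; cases "b < n"; simp; linarith)+

lemma indep_sym: "indep n a b \<Longrightarrow> indep n b a"
  by (frule indepD(4), frule indepD(8)) (simp add: indep_def)

lemma op_neq: "a < 2 * n \<Longrightarrow> op n a \<noteq> a" "a < 2 * n \<Longrightarrow> a \<noteq> op n a"
  by (auto simp: op_def split: if_splits)

lemma indep_op: "indep n a b \<Longrightarrow> indep n (op n a) b" "indep n a b \<Longrightarrow> indep n a (op n b)"
  by (frule indepD(7), frule indepD(9), simp add: indep_def)
    (frule indepD(3), frule indepD(5), simp add: indep_def)

text \<open>A root vector of \<open>sl\<^bsub>2n\<^esub>\<close> graded by the torus of matrices \<open>diag(t, -t)\<close>: the root
  spaces of \<open>E\<^bsub>ab\<^esub>\<close> and \<open>E\<^bsub>op b, op a\<^esub>\<close> coincide.\<close>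

definition Y :: "nat \<Rightarrow> (nat \<Rightarrow> complex) \<Rightarrow> (nat \<Rightarrow> complex) \<Rightarrow> nat \<Rightarrow> nat \<Rightarrow> tup" where
  "Y n g h a b = E g a b + E h (op n b) (op n a)"

lemma Y_swap: "a < 2 * n \<Longrightarrow> b < 2 * n \<Longrightarrow> Y n g h (op n b) (op n a) = Y n h g a b"
  by (simp add: Y_def add.commute)

lemma Y_linear:
  "Y n (g + g') (h + h') a b = Y n g h a b + Y n g' h' a b"
  "Y n (- g) (- h) a b = - Y n g h a b"
  "tscale c (Y n g h a b) = Y n (\<lambda>k. c * g k) (\<lambda>k. c * h k) a b"
  "Y n 0 0 a b = 0"
  by (simp_all add: Y_def E_linear tscale_simps algebra_simps)

text \<open>The units E_ab and E_bd compose in the given order, their partners only in the reverse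
  order; this puts the minus sign on the second coefficient.\<close>

lemma tbr_Y_chain:
  assumes "indep n a b" "indep n b d" "indep n a d"
  shows "tbr (2 * n) (Y n g h a b) (Y n g' h' b d) = Y n (g * g') (- (h * h')) a d"
  using assms[THEN indepD(1)] assms[THEN indepD(2)] assms[THEN indepD(3)] assms[THEN indepD(4)]
    assms[THEN indepD(5)] assms[THEN indepD(6)] assms[THEN indepD(7)] assms[THEN indepD(8)]
    assms[THEN indepD(9)] assms[THEN indepD(10)]
  by (simp add: tbr_def Y_def tmul_linear tmul_E E_linear op_neq mult.commute[of h' h])

lemma tbr_swap: "tbr N y x = - tbr N x y"
  by (simp add: tbr_def)

lemma tbr_linear:
  "tbr N (x + x') y = tbr N x y + tbr N x' y"
  "tbr N x (y + y') = tbr N x y + tbr N x y'"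
  "tbr N (- x) y = - tbr N x y"
  "tbr N x (- y) = - tbr N x y"
  "tbr N (x - x') y = tbr N x y - tbr N x' y"
  "tbr N x (y - y') = tbr N x y - tbr N x y'"
  "tbr N 0 y = 0"
  "tbr N x 0 = 0"
  by (simp_all add: tbr_def tmul_linear)

lemma tbr_Y_zero:
  assumes "indep n a b" "indep n b d" "indep n a d"
  shows "tbr (2 * n) (Y n g h a b) (Y n g' h' d b) = 0"
    and "tbr (2 * n) (Y n g h b a) (Y n g' h' b d) = 0"
  using assms[THEN indepD(1)] assms[THEN indepD(2)] assms[THEN indepD(3)] assms[THEN indepD(4)]
    assms[THEN indepD(5)] assms[THEN indepD(6)] assms[THEN indepD(7)] assms[THEN indepD(8)]
    assms[THEN indepD(9)] assms[THEN indepD(10)]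
  by (simp_all add: tbr_def Y_def tmul_linear tmul_E E_linear op_neq)

text \<open>The inner bracket is a root vector from \<open>a\<close> to \<open>d\<close>, up to
  sign. It has the same start or the same end as the outer factor and so commutes with it.\<close>

lemma tbr_Y_serre:
  assumes "indep n a b" "indep n b d" "indep n a d"
  shows "tbr (2 * n) (Y n g h a b) (tbr (2 * n) (Y n g h a b) (Y n g' h' b d)) = 0"
    and "tbr (2 * n) (Y n g' h' b d) (tbr (2 * n) (Y n g' h' b d) (Y n g h a b)) = 0"
proof -
  show "tbr (2 * n) (Y n g h a b) (tbr (2 * n) (Y n g h a b) (Y n g' h' b d)) = 0"
    using assms indep_sym by (simp add: tbr_Y_chain tbr_Y_zero)
  show "tbr (2 * n) (Y n g' h' b d) (tbr (2 * n) (Y n g' h' b d) (Y n g h a b)) = 0"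
    using assms indep_sym by (subst (2) tbr_swap) (simp add: tbr_Y_chain tbr_linear tbr_Y_zero)
qed

lemma tbr_Y_disjoint:
  assumes "indep n a c" "indep n a d" "indep n b c" "indep n b d"
  shows "tbr (2 * n) (Y n g h a b) (Y n g' h' c d) = 0"
  using assms[THEN indepD(1)] assms[THEN indepD(2)] assms[THEN indepD(3)] assms[THEN indepD(4)]
    assms[THEN indepD(5)] assms[THEN indepD(6)] assms[THEN indepD(7)] assms[THEN indepD(8)]
    assms[THEN indepD(9)] assms[THEN indepD(10)]
  by (simp add: tbr_def Y_def tmul_linear tmul_E E_linear op_neq)

definition H :: "nat \<Rightarrow> (nat \<Rightarrow> complex) \<Rightarrow> nat \<Rightarrow> nat \<Rightarrow> tup" where
  "H n g a b = E g a a - E g b b + E g (op n b) (op n b) - E g (op n a) (op n a)"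

lemma tmul_Y_opposite:
  assumes "indep n a b"
  shows "tmul (2 * n) (Y n g h a b) (Y n g' h' b a) = E (g * g') a a + E (h * h') (op n b) (op n b)"
  using assms[THEN indepD(1)] assms[THEN indepD(2)] assms[THEN indepD(3)] assms[THEN indepD(4)]
    assms[THEN indepD(5)] assms[THEN indepD(6)] assms[THEN indepD(7)] assms[THEN indepD(8)]
    assms[THEN indepD(9)] assms[THEN indepD(10)]
  by (simp add: Y_def tmul_linear tmul_E)

text \<open>The bracket lies along the coroot because both coefficient products agree, which is why
  the f_i carry the inverse coefficients of the e_i.\<close>

lemma tbr_Y_opposite:
  assumes "indep n a b" "g * g' = u" "h * h' = u"
  shows "tbr (2 * n) (Y n g h a b) (Y n g' h' b a) = H n u a b"
proof -
  have u: "g' * g = u" "h' * h = u"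
    using assms(2,3) by (simp_all only: mult.commute)
  show ?thesis
    unfolding tbr_def H_def tmul_Y_opposite[OF assms(1)] tmul_Y_opposite[OF indep_sym[OF assms(1)]]
      u assms(2,3)
    by (simp add: fun_eq_iff)
qed

text \<open>The diagonal entry at \<open>c\<close> of the coroot \<open>H n g a b\<close> with
  coefficient 1.\<close>

definition wt :: "nat \<Rightarrow> nat \<Rightarrow> nat \<Rightarrow> nat \<Rightarrow> complex" where
  "wt n a b c = of_bool (c = a) - of_bool (c = b) + of_bool (c = op n b) - of_bool (c = op n a)"

lemma wt_op: "a < 2 * n \<Longrightarrow> b < 2 * n \<Longrightarrow> c < 2 * n \<Longrightarrow> wt n a b (op n c) = - wt n a b c"
proof -
  assume a: "a < 2 * n" "b < 2 * n" "c < 2 * n"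
  have "op n c = x \<longleftrightarrow> c = op n x" if "x < 2 * n" for x
    using a(3) that op_simps(2) by metis
  then show ?thesis
    using a by (simp add: wt_def)
qed

lemma tbr_H_E:
  assumes "a < 2 * n" "b < 2 * n" "c < 2 * n" "d < 2 * n" "u * g = g"
  shows "tbr (2 * n) (H n u a b) (E g c d) = tscale (wt n a b c - wt n a b d) (E g c d)"
proof -
  have gu: "g * u = g"
    using assms(5) by (simp only: mult.commute)
  have l: "tmul (2 * n) (E u x x) (E g c d) = tscale (of_bool (c = x)) (E g c d)" if "x < 2 * n" for x
    using that by (simp only: tmul_E assms(5)) (simp add: tscale_def fun_eq_iff)
  have r: "tmul (2 * n) (E g c d) (E u x x) = tscale (of_bool (d = x)) (E g c d)" for x
    using assms(4) by (simp only: tmul_E gu) (simp add: tscale_def fun_eq_iff)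
  show ?thesis
    unfolding tbr_def H_def tmul_linear l[OF assms(1)] l[OF assms(2)] l[OF op_simps(1)[OF assms(1)]]
      l[OF op_simps(1)[OF assms(2)]] r wt_def
    by (simp add: tscale_def fun_eq_iff algebra_simps)
qed

lemma tbr_H_Y:
  assumes "a < 2 * n" "b < 2 * n" "c < 2 * n" "d < 2 * n" "u * g = g" "u * h = h"
  shows "tbr (2 * n) (H n u a b) (Y n g h c d) = tscale (wt n a b c - wt n a b d) (Y n g h c d)"
  using assms by (simp add: Y_def tbr_linear tbr_H_E wt_op tscale_simps)

lemma wt_Mn:
  assumes "3 \<le> n" "i \<in> {1..n}" "j \<in> {1..n}"
  shows "wt n (i - 1) i (j - 1) - wt n (i - 1) i j = of_int (Mn n i j)"
proof -
  obtain i' j' where ij: "i = Suc i'" "j = Suc j'" "i' < n" "j' < n"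
    using assms by (cases i; cases j) auto
  \<comment> \<open>For \<open>x <= n\<close> the partner terms show up only at the seam of the
    cycle, through \<open>op n n = 0\<close> and \<open>op n 0 = n\<close>. They produce the two
    corner entries of the matrix.\<close>
  have wt: "wt n i' (Suc i') x = of_bool (x = i') - of_bool (x = Suc i') +
      of_bool (Suc i' = n \<and> x = 0) - of_bool (i' = 0 \<and> x = n)" if "x \<le> n" for x
  proof (cases "Suc i' < n")
    case True
    then show ?thesis
      using that by (cases "x = n") (simp_all add: wt_def op_def)
  next
    case False
    then have "Suc i' = n"
      using ij by simp
    then show ?thesis
      using that assms(1) by (cases "x = n") (simp_all add: wt_def op_def)
  qed
  have "wt n i' (Suc i') j' - wt n i' (Suc i') (Suc j') =
      of_bool (j' = i') - of_bool (j' = Suc i') + of_bool (Suc i' = n \<and> j' = 0) -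
      (of_bool (Suc j' = i') - of_bool (j' = i') - of_bool (i' = 0 \<and> Suc j' = n))"
    using wt[of j'] wt[of "Suc j'"] ij by simp
  moreover consider "j' = i'" | "j' = Suc i'" | "i' = Suc j'" | "j' \<noteq> i'" "j' \<noteq> Suc i'" "i' \<noteq> Suc j'"
    by blast
  then have "of_bool (j' = i') - of_bool (j' = Suc i') + of_bool (Suc i' = n \<and> j' = 0) -
      (of_bool (Suc j' = i') - of_bool (j' = i') - of_bool (i' = 0 \<and> Suc j' = n)) =
      (of_int (Mn n (Suc i') (Suc j')) :: complex)"
  proof cases
    case 4
    then show ?thesis
      using assms(1) ij(3,4)
      by (cases "i' = 0 \<and> Suc j' = n"; cases "Suc i' = n \<and> j' = 0") (simp_all add: Mn_def)
  qed (use assms(1) in \<open>auto simp: Mn_def\<close>)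
  ultimately show ?thesis
    using ij by simp
qed

lemma tscale_uminus: "tscale (- a) x = - tscale a x"
  by (simp add: tscale_def fun_eq_iff)

lemma indepI:
  assumes "x \<le> n" "y \<le> n" "x \<noteq> y" "0 < n" "\<not> (x = 0 \<and> y = n)" "\<not> (x = n \<and> y = 0)"
  shows "indep n x y"
  using assms by (auto simp: indep_def op_def)

section \<open>The twisted generators and the relations of \<open>gim\<close>\<close>

locale twisted =
  fixes n :: nat and K :: "nat set" and q :: "nat \<Rightarrow> complex"
  assumes n: "3 \<le> n" and q_nonzero: "k \<in> K \<Longrightarrow> q k \<noteq> 0" and q_outside: "k \<notin> K \<Longrightarrow> q k = 0"
begin

definition u :: "nat \<Rightarrow> complex" where "u = (\<lambda>k. of_bool (k \<in> K))"

text \<open>As \<open>inverse 0 = 0\<close>, this vanishes outside \<open>K\<close> like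
  \<open>q\<close>, and \<open>q * r\<close> is \<open>u\<close>, the unit of the functions
  supported on \<open>K\<close>.\<close>

definition r :: "nat \<Rightarrow> complex" where "r = (\<lambda>k. inverse (q k))"

lemma unit_simps [simp]:
  "u * u = u" "u * q = q" "q * u = q" "q * r = u" "r * q = u" "u * r = r" "r * u = r"
  using q_nonzero q_outside by (auto simp: u_def r_def fun_eq_iff)

definition s :: "nat \<Rightarrow> nat \<Rightarrow> complex" where "s i = (if i < n then - u else q)"

definition s' :: "nat \<Rightarrow> nat \<Rightarrow> complex" where "s' i = (if i < n then - u else r)"

lemma s_simps: "s i * s' i = u" "s' i * s i = u" "u * s i = s i" "u * s' i = s' i"
  by (simp_all add: s_def s'_def)

definition ge :: "nat \<Rightarrow> tup" where "ge i = Y n u (s i) (i - 1) i"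

definition gf :: "nat \<Rightarrow> tup" where "gf i = Y n u (s' i) i (i - 1)"

definition gh :: "nat \<Rightarrow> tup" where "gh i = H n u (i - 1) i"

abbreviation br :: "tup \<Rightarrow> tup \<Rightarrow> tup" where "br \<equiv> tbr (2 * n)"

lemma index_less: "i \<in> {1..n} \<Longrightarrow> i - 1 < 2 * n" "i \<in> {1..n} \<Longrightarrow> i < 2 * n"
  using n by auto

lemma rel_weight:
  assumes "i \<in> {1..n}" "j \<in> {1..n}"
  shows "br (gh i) (ge j) = tscale (of_int (Mn n i j)) (ge j)"
    and "br (gh i) (gf j) = tscale (- of_int (Mn n i j)) (gf j)"
proof -
  have "- complex_of_int (Mn n i j) = wt n (i - 1) i j - wt n (i - 1) i (j - 1)"
    unfolding wt_Mn[OF n assms, symmetric] by (rule minus_diff_eq)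
  then show "br (gh i) (gf j) = tscale (- of_int (Mn n i j)) (gf j)"
    unfolding gh_def gf_def
    by (simp only: tbr_H_Y[OF index_less[OF assms(1)] index_less(2,1)[OF assms(2)]] unit_simps s_simps)
  show "br (gh i) (ge j) = tscale (of_int (Mn n i j)) (ge j)"
    unfolding gh_def ge_def wt_Mn[OF n assms, symmetric]
    by (simp only: tbr_H_Y[OF index_less[OF assms(1)] index_less[OF assms(2)]] unit_simps s_simps)
qed

lemma indep_adjacent: "i \<in> {1..n} \<Longrightarrow> indep n (i - 1) i"
  by (rule indepI) (use n in auto)

lemma rel_coroot: "i \<in> {1..n} \<Longrightarrow> br (ge i) (gf i) = gh i"
  unfolding ge_def gf_def gh_def by (rule tbr_Y_opposite[OF indep_adjacent]) (simp_all add: s_simps)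

lemma Mn_cases:
  assumes "i \<in> {1..n}" "j \<in> {1..n}" "i \<noteq> j"
  obtains (up) "Mn n i j = -1" "j = Suc i"
    | (down) "Mn n i j = -1" "i = Suc j"
    | (first) "Mn n i j = 1" "i = 1" "j = n"
    | (last) "Mn n i j = 1" "i = n" "j = 1"
    | (zero) "Mn n i j = 0" "Suc i < j \<and> \<not> (i = 1 \<and> j = n) \<or> Suc j < i \<and> \<not> (i = n \<and> j = 1)"
proof -
  consider "j = Suc i" | "i = Suc j" | "i = 1" "j = n" | "i = n" "j = 1"
    | "j \<noteq> Suc i" "i \<noteq> Suc j" "\<not> (i = 1 \<and> j = n)" "\<not> (i = n \<and> j = 1)"
    by blast
  then show ?thesis
  proof cases
    case 1
    then show ?thesis using up by (simp add: Mn_def)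
  next
    case 2
    then show ?thesis using down by (simp add: Mn_def)
  next
    case 3
    then show ?thesis using first n by (simp add: Mn_def)
  next
    case 4
    then show ?thesis using last n by (simp add: Mn_def)
  next
    case 5
    show ?thesis
    proof (rule zero)
      show "Mn n i j = 0"
        using 5 assms(3) unfolding Mn_def by simp
      show "Suc i < j \<and> \<not> (i = 1 \<and> j = n) \<or> Suc j < i \<and> \<not> (i = n \<and> j = 1)"
        using 5 assms(3) by linarith
    qed
  qed
qed

lemma rel_zero:
  assumes "i \<in> {1..n}" "j \<in> {1..n}"
    and "Suc i < j \<and> \<not> (i = 1 \<and> j = n) \<or> Suc j < i \<and> \<not> (i = n \<and> j = 1)"
  shows "br (ge i) (gf j) = 0" "br (gf i) (ge j) = 0" "br (ge i) (ge j) = 0" "br (gf i) (gf j) = 0"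
proof -
  have "indep n (i - 1) (j - 1)" "indep n (i - 1) j" "indep n i (j - 1)" "indep n i j"
    by (rule indepI; use assms n in auto)+
  then show "br (ge i) (gf j) = 0" "br (gf i) (ge j) = 0" "br (ge i) (ge j) = 0" "br (gf i) (gf j) = 0"
    unfolding ge_def gf_def by (simp_all add: tbr_Y_disjoint)
qed

lemma rel_adjacent:
  assumes "i \<in> {1..n}" "Suc i \<in> {1..n}"
  shows "br (ge i) (gf (Suc i)) = 0" "br (gf i) (ge (Suc i)) = 0"
    "br (ge (Suc i)) (gf i) = 0" "br (gf (Suc i)) (ge i) = 0"
    "br (ge i) (br (ge i) (ge (Suc i))) = 0" "br (gf i) (br (gf i) (gf (Suc i))) = 0"
    "br (ge (Suc i)) (br (ge (Suc i)) (ge i)) = 0" "br (gf (Suc i)) (br (gf (Suc i)) (gf i)) = 0"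
proof -
  have i: "indep n (i - 1) i" "indep n i (Suc i)" "indep n (i - 1) (Suc i)"
    by (rule indepI; use assms n in auto)+
  note j = i[THEN indep_sym]
  show "br (ge i) (gf (Suc i)) = 0" "br (gf i) (ge (Suc i)) = 0"
    "br (ge (Suc i)) (gf i) = 0" "br (gf (Suc i)) (ge i) = 0"
    "br (ge i) (br (ge i) (ge (Suc i))) = 0" "br (gf i) (br (gf i) (gf (Suc i))) = 0"
    "br (ge (Suc i)) (br (ge (Suc i)) (ge i)) = 0" "br (gf (Suc i)) (br (gf (Suc i)) (gf i)) = 0"
    unfolding ge_def gf_def diff_Suc_1
    by (rule tbr_Y_zero tbr_Y_serre; rule i j)+
qed

text \<open>After relabelling \<open>ge n\<close>, \<open>gf n\<close> by \<open>Y_swap\<close>, the node \<open>n\<close> with \<open>e\<close> and \<open>f\<close> exchanged is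
  linked to the node \<open>1\<close> exactly as consecutive nodes are.\<close>

lemma rel_ends:
  shows "br (ge 1) (ge n) = 0" "br (gf 1) (gf n) = 0" "br (ge n) (ge 1) = 0" "br (gf n) (gf 1) = 0"
    "br (ge 1) (br (ge 1) (gf n)) = 0" "br (gf 1) (br (gf 1) (ge n)) = 0"
    "br (ge n) (br (ge n) (gf 1)) = 0" "br (gf n) (br (gf n) (ge 1)) = 0"
proof -
  let ?d = "op n (n - 1)"
  have op: "op n n = 0"
    by (simp add: op_def)
  have en: "ge n = Y n (s n) u 0 ?d" and fn: "gf n = Y n (s' n) u ?d 0"
    using Y_swap[of "n - 1" n n "s n" u] Y_swap[of n n "n - 1" "s' n" u] n
    unfolding ge_def gf_def op by simp_all
  have "indep n 0 (n - 1)"  "indep n 1 (n - 1)" and 1: "indep n 0 1"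
    by (rule indepI; use n in auto)+
  then have i: "indep n 0 ?d" "indep n ?d 0" "indep n 1 ?d" "indep n ?d 1" "indep n 0 1" "indep n 1 0"
    by (blast intro: indep_op indep_sym)+
  show "br (ge 1) (ge n) = 0" "br (gf 1) (gf n) = 0" "br (ge n) (ge 1) = 0" "br (gf n) (gf 1) = 0"
    "br (ge 1) (br (ge 1) (gf n)) = 0" "br (gf 1) (br (gf 1) (ge n)) = 0"
    "br (ge n) (br (ge n) (gf 1)) = 0" "br (gf n) (br (gf n) (ge 1)) = 0"
    unfolding en fn unfolding ge_def gf_def diff_self_eq_0
    by (rule tbr_Y_zero tbr_Y_serre; rule i)+
qed

text \<open>The numbering is that of \<open>gen_e\<close>, \<open>gen_f\<close> and
  \<open>gen_h\<close>. The value 0 at all other letters keeps every value bounded, as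
  \<open>eval_amul\<close> requires.\<close>

definition gen_val :: "nat \<Rightarrow> tup" where
  "gen_val x = (if x \<in> {1..n} then ge x else if x \<in> {n+1..2*n} then gf (x - n)
     else if x \<in> {2*n+1..3*n} then gh (x - 2*n) else 0)"

lemma gen_val_bounded: "2 * n \<le> i \<or> 2 * n \<le> j \<Longrightarrow> gen_val x k i j = 0"
proof -
  assume ij: "2 * n \<le> i \<or> 2 * n \<le> j"
  have E: "E g a b k i j = 0" if "a < 2 * n" "b < 2 * n" for g a b
    using that ij by (auto simp: E_def)
  have "ge l k i j = 0" "gf l k i j = 0" "gh l k i j = 0" if "l \<in> {1..n}" for l
    using index_less[OF that] by (simp_all add: ge_def gf_def gh_def Y_def H_def E)
  moreover have "x \<in> {n+1..2*n} \<Longrightarrow> x - n \<in> {1..n}" "x \<in> {2*n+1..3*n} \<Longrightarrow> x - 2*n \<in> {1..n}"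
    by (simp_all, linarith+)
  ultimately show ?thesis
    unfolding gen_val_def by (simp only: zero_fun_apply split: if_split) blast
qed

definition ev :: "(nat list \<Rightarrow> complex) \<Rightarrow> tup" where "ev = eval (2 * n) gen_val"

lemma ev_gen:
  assumes "i \<in> {1..n}"
  shows "ev (gen_e n i) = ge i" "ev (gen_f n i) = gf i" "ev (gen_h n i) = gh i"
proof -
  have "eval (2 * n) gen_val (letter x) = gen_val x" for x
    by (rule eval_letter) (simp add: gen_val_bounded)
  then show "ev (gen_e n i) = ge i" "ev (gen_f n i) = gf i" "ev (gen_h n i) = gh i"
    using assms unfolding ev_def gen_e_def gen_f_def gen_h_def by (simp_all add: gen_val_def)
qed

lemma ev_hom:
  assumes "x \<in> carr (free_lie n)" "y \<in> carr (free_lie n)"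
  shows "ev (pls (free_lie n) x y) = ev x + ev y"
    and "ev (scl (free_lie n) a x) = tscale a (ev x)"
    and "ev (brk (free_lie n) x y) = br (ev x) (ev y)"
proof -
  have fin: "finite (asupp x)" "finite (asupp y)"
    using assms free_lie_carr by auto
  have row: "row_bounded (2 * n) (gen_val x)" for x
    by (simp add: row_bounded_def gen_val_bounded)
  show "ev (pls (free_lie n) x y) = ev x + ev y" "ev (scl (free_lie n) a x) = tscale a (ev x)"
    unfolding ev_def free_lie_sel by (rule eval_plus[OF fin] eval_scale[OF fin(1)])+
  show "ev (brk (free_lie n) x y) = br (ev x) (ev y)"
    unfolding ev_def free_lie_sel tbr_def eval_minus[OF finite_asupp_amul[OF fin] finite_asupp_amul[OF fin(2,1)]]
      eval_amul[OF row fin] eval_amul[OF row fin(2,1)] ..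
qed

lemma ev_zero: "ev (\<lambda>w. 0) = 0"
  by (simp add: ev_def eval_def asupp_def)

lemma gim_rels_kernel:
  assumes "p \<in> gim_rels n"
  shows "p \<in> carr (free_lie n)" "ev p = 0"
proof -
  interpret F: lie "free_lie n"
    by unfold_locales (rule lie_algebra_free_lie)
  note gens = gens_free_lie
  \<comment> \<open>Off-diagonal entries of the matrix are 0, 1 or -1, so only first and second
    powers of \<open>ad\<close> occur.\<close>
  have ad_pow_Suc: "ad_pow L x (Suc 0) y = brk L x y" "ad_pow L x 2 y = brk L x (brk L x y)"
    for L :: "(nat list \<Rightarrow> complex) lie" and x y
    by (simp_all add: ad_pow_def numeral_2_eq_2)
  have "p \<in> carr (free_lie n) \<and> ev p = 0"
    using assms unfolding gim_rels_def Let_def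
  proof (elim UnE CollectE exE conjE)
    fix i j assume p: "p = lsub (free_lie n) (brk (free_lie n) (gen_h n i) (gen_e n j))
        (scl (free_lie n) (of_int (Mn n i j)) (gen_e n j))" and i: "i \<in> {1..n}" "j \<in> {1..n}"
    show ?thesis
      unfolding p lsub_def using gens[OF i(1)] gens[OF i(2)] rel_weight[OF i]
      by (simp add: ev_hom ev_gen[OF i(1)] ev_gen[OF i(2)] tscale_simps tscale_uminus)
  next
    fix i j assume p: "p = lsub (free_lie n) (brk (free_lie n) (gen_h n i) (gen_f n j))
        (scl (free_lie n) (- of_int (Mn n i j)) (gen_f n j))" and i: "i \<in> {1..n}" "j \<in> {1..n}"
    show ?thesis
      unfolding p lsub_def using gens[OF i(1)] gens[OF i(2)] rel_weight[OF i]
      by (simp add: ev_hom ev_gen[OF i(1)] ev_gen[OF i(2)] tscale_simps tscale_uminus)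
  next
    fix i assume p: "p = lsub (free_lie n) (brk (free_lie n) (gen_e n i) (gen_f n i)) (gen_h n i)"
      and i: "i \<in> {1..n}"
    show ?thesis
      unfolding p lsub_def using gens[OF i] rel_coroot[OF i]
      by (simp add: ev_hom ev_gen[OF i] tscale_simps)
  next
    fix p' i j
    assume i: "i \<in> {1..n}" "j \<in> {1..n}" "i \<noteq> j" and m: "Mn n i j \<le> 0" and p: "p = p'"
      and rel: "p' = brk (free_lie n) (gen_e n i) (gen_f n j) \<or> p' = brk (free_lie n) (gen_f n i) (gen_e n j) \<or>
         p' = ad_pow (free_lie n) (gen_e n i) (nat (- Mn n i j + 1)) (gen_e n j) \<or>
         p' = ad_pow (free_lie n) (gen_f n i) (nat (- Mn n i j + 1)) (gen_f n j)"
    show ?thesis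
    proof (cases rule: Mn_cases[OF i, case_names up down first last zero])
      case up
      then show ?thesis
        using gens[OF i(1)] gens[OF i(2)] ev_gen[OF i(1)] ev_gen[OF i(2)] rel_adjacent[of i] i
          p rel by (auto simp: ad_pow_Suc ev_hom)
    next
      case down
      then show ?thesis
        using gens[OF i(1)] gens[OF i(2)] ev_gen[OF i(1)] ev_gen[OF i(2)] rel_adjacent[of j] i
          p rel by (auto simp: ad_pow_Suc ev_hom)
    next
      case zero
      then show ?thesis
        using gens[OF i(1)] gens[OF i(2)] ev_gen[OF i(1)] ev_gen[OF i(2)] rel_zero[OF i(1,2) zero(2)]
          p rel by (auto simp: ad_pow_Suc ev_hom)
    qed (use m in simp_all)
  next
    fix p' i j
    assume i: "i \<in> {1..n}" "j \<in> {1..n}" "i \<noteq> j" and m: "0 < Mn n i j" and p: "p = p'"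
      and rel: "p' = brk (free_lie n) (gen_e n i) (gen_e n j) \<or> p' = brk (free_lie n) (gen_f n i) (gen_f n j) \<or>
         p' = ad_pow (free_lie n) (gen_e n i) (nat (Mn n i j + 1)) (gen_f n j) \<or>
         p' = ad_pow (free_lie n) (gen_f n i) (nat (Mn n i j + 1)) (gen_e n j)"
    show ?thesis
    proof (cases rule: Mn_cases[OF i, case_names up down first last zero])
      case first
      then show ?thesis
        using gens[OF i(1)] gens[OF i(2)] ev_gen[OF i(1)] ev_gen[OF i(2)] rel_ends
          p rel by (auto simp: ad_pow_Suc ev_hom)
    next
      case last
      then show ?thesis
        using gens[OF i(1)] gens[OF i(2)] ev_gen[OF i(1)] ev_gen[OF i(2)] rel_ends
          p rel by (auto simp: ad_pow_Suc ev_hom)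
    qed (use m in simp_all)
  qed
  then show "p \<in> carr (free_lie n)" "ev p = 0"
    by blast+
qed

end

section \<open>Generation of the direct sum\<close>

lemma sum_tup_apply: "(\<Sum>w\<in>A. f w :: tup) k i j = (\<Sum>w\<in>A. f w k i j)"
  by (induction A rule: infinite_finite_induct) simp_all

lemma ex_third:
  assumes "3 \<le> (n::nat)"
  obtains l where "l < n" "l \<noteq> i" "l \<noteq> j"
proof -
  have "(0 \<noteq> i \<and> 0 \<noteq> j) \<or> (1 \<noteq> i \<and> 1 \<noteq> j) \<or> (2 \<noteq> i \<and> 2 \<noteq> j)"
    by linarith
  then show ?thesis
    using that[of 0] that[of 1] that[of 2] assms by linarith
qed

lemma indep_less: "i < n \<Longrightarrow> j < n \<Longrightarrow> i \<noteq> j \<Longrightarrow> indep n i j"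
  by (rule indepI) auto

text \<open>\<open>G\<close> stands for any subspace closed under brackets that contains the
  generators; it will be the image of the free Lie algebra. Only distinct summands are separated:
  \<open>q k * q k = 1\<close> remains possible and marks the symplectic and orthogonal
  ones.\<close>

locale twisted_gen = twisted +
  fixes G :: "tup set"
  assumes K: "finite K"
    and q_sep: "k \<in> K \<Longrightarrow> l \<in> K \<Longrightarrow> k \<noteq> l \<Longrightarrow> q k \<noteq> q l \<and> q k * q l \<noteq> 1"
    and G_gens: "i \<in> {1..n} \<Longrightarrow> ge i \<in> G" "i \<in> {1..n} \<Longrightarrow> gf i \<in> G"
    and G_plus: "x \<in> G \<Longrightarrow> y \<in> G \<Longrightarrow> x + y \<in> G"
    and G_scale: "x \<in> G \<Longrightarrow> tscale c x \<in> G"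
    and G_br: "x \<in> G \<Longrightarrow> y \<in> G \<Longrightarrow> br x y \<in> G"
begin

lemma G_uminus: "x \<in> G \<Longrightarrow> - x \<in> G"
  using G_scale[of x "-1"] by (simp add: tscale_simps)

lemma G_zero: "0 \<in> G"
proof -
  have "tscale 0 (ge 1) = 0"
    by (simp add: tscale_def fun_eq_iff)
  then show ?thesis
    using G_scale[OF G_gens(1)[of 1], of 0] n by simp
qed

lemma G_sum: "(\<And>w. w \<in> A \<Longrightarrow> f w \<in> G) \<Longrightarrow> (\<Sum>w\<in>A. f w) \<in> G"
  by (induction A rule: infinite_finite_induct) (auto intro: G_plus G_zero)

text \<open>The sign makes the bracket of root vectors multiplicative in both parameters.\<close>

definition S :: "nat \<Rightarrow> nat \<Rightarrow> (nat \<Rightarrow> complex) \<Rightarrow> (nat \<Rightarrow> complex) \<Rightarrow> bool" where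
  "S a b g h \<longleftrightarrow> Y n g (- h) a b \<in> G"

text \<open>With the sign in \<open>S\<close> absorbed, the generators of node \<open>n\<close> have
  second parameter \<open>- q\<close> and \<open>- r\<close>. These are the quantities that multiply
  along chains of brackets.\<close>

definition p :: "nat \<Rightarrow> complex" where "p = - q"

definition p' :: "nat \<Rightarrow> complex" where "p' = - r"

lemma p_simps [simp]:
  "p * p' = u" "p' * p = u" "u * p = p" "p * u = p" "u * p' = p'" "p' * u = p'"
  by (simp_all add: p_def p'_def)

lemma S_chain:
  assumes "S a b g h" "S b d g' h'" "indep n a b" "indep n b d" "indep n a d"
  shows "S a d (g * g') (h * h')"
proof -
  have "- (- h * - h') = - (h * h')"
    by simp
  then show ?thesis
    using G_br assms(1,2) tbr_Y_chain[OF assms(3-5), of g "- h" g' "- h'"]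
    unfolding S_def by metis
qed

lemma S_linear:
  "S a b g h \<Longrightarrow> S a b g' h' \<Longrightarrow> S a b (g + g') (h + h')"
  "S a b g h \<Longrightarrow> S a b (\<lambda>k. c * g k) (\<lambda>k. c * h k)"
proof -
  have *: "- (h + h') = - h + - h'" "- (\<lambda>k. c * h k) = (\<lambda>k. c * (- h) k)"
    by (simp_all add: fun_eq_iff)
  show "S a b g h \<Longrightarrow> S a b g' h' \<Longrightarrow> S a b (g + g') (h + h')"
    unfolding S_def * Y_linear by (rule G_plus)
  show "S a b g h \<Longrightarrow> S a b (\<lambda>k. c * g k) (\<lambda>k. c * h k)"
    unfolding S_def * Y_linear(3)[symmetric] by (rule G_scale)
qed

lemma S_swap:
  assumes "S a b g h" "a < 2 * n" "b < 2 * n"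
  shows "S (op n b) (op n a) h g"
proof -
  have "Y n (- h) g (op n b) (op n a) \<in> G"
    using assms unfolding S_def by (simp add: Y_swap)
  then have "- Y n (- h) g (op n b) (op n a) \<in> G"
    by (rule G_uminus)
  moreover have "- Y n (- h) g (op n b) (op n a) = Y n h (- g) (op n b) (op n a)"
    unfolding Y_linear(2)[symmetric] by simp
  ultimately show ?thesis
    unfolding S_def by simp
qed

text \<open>The nodes below \<open>n\<close> form a chain of type A; brackets along it reach all
  weights eps_i - eps_j with trivial parameters.\<close>

lemma S_up: "i < j \<Longrightarrow> j < n \<Longrightarrow> S i j u u \<and> S j i u u"
proof (induction j)
  case (Suc j)
  have "ge (Suc j) \<in> G" "gf (Suc j) \<in> G"
    using G_gens[of "Suc j"] Suc.prems by auto
  then have *: "S j (Suc j) u u" "S (Suc j) j u u"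
    using Suc.prems by (auto simp: S_def ge_def gf_def s_def s'_def)
  show ?case
  proof (cases "i = j")
    case True
    then show ?thesis using * by blast
  next
    case False
    then have IH: "S i j u u" "S j i u u"
      using Suc by auto
    have "indep n i j" "indep n j (Suc j)" "indep n i (Suc j)"
      using False Suc.prems by (auto intro: indep_less)
    then show ?thesis
      using S_chain[OF IH(1) *(1)] S_chain[OF *(2) IH(2)] by (simp add: indep_sym)
  qed
qed simp

lemma S_same: "i < n \<Longrightarrow> j < n \<Longrightarrow> i \<noteq> j \<Longrightarrow> S i j u u"
  using S_up[of i j] S_up[of j i] by (cases "i < j") auto

lemma S_same_op: "i < n \<Longrightarrow> j < n \<Longrightarrow> i \<noteq> j \<Longrightarrow> S (op n i) (op n j) u u"
  by (rule S_swap[OF S_same[of j i]]) auto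

text \<open>\<open>\<alpha>\<close> and \<open>\<beta>\<close> will each be the identity or
  \<open>op n\<close>. Root vectors inside one family have parameters \<open>(u, u)\<close>, so
  bracketing with them moves the endpoints and leaves \<open>(u, w)\<close> unchanged.\<close>

lemma S_spread:
  assumes base: "S (\<alpha> i0) (\<beta> j0) u w" "i0 < n" "j0 < n" "i0 \<noteq> j0" "u * w = w"
    and \<alpha>: "\<And>i j. i < n \<Longrightarrow> j < n \<Longrightarrow> i \<noteq> j \<Longrightarrow> S (\<alpha> i) (\<alpha> j) u u"
      "\<And>i j. i < n \<Longrightarrow> j < n \<Longrightarrow> i \<noteq> j \<Longrightarrow> indep n (\<alpha> i) (\<alpha> j)"
    and \<beta>: "\<And>i j. i < n \<Longrightarrow> j < n \<Longrightarrow> i \<noteq> j \<Longrightarrow> S (\<beta> i) (\<beta> j) u u"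
      "\<And>i j. i < n \<Longrightarrow> j < n \<Longrightarrow> i \<noteq> j \<Longrightarrow> indep n (\<beta> i) (\<beta> j)"
    and \<alpha>\<beta>: "\<And>i j. i < n \<Longrightarrow> j < n \<Longrightarrow> i \<noteq> j \<Longrightarrow> indep n (\<alpha> i) (\<beta> j)"
    and ij: "i < n" "j < n" "i \<noteq> j"
  shows "S (\<alpha> i) (\<beta> j) u w"
proof -
  have wu: "w * u = w"
    using base(5) by (simp only: mult.commute)
  have 1: "S (\<alpha> i) (\<beta> j0) u w" if "i < n" "i \<noteq> j0" for i
  proof (cases "i = i0")
    case False
    have "S (\<alpha> i) (\<beta> j0) (u * u) (u * w)"
      using that False base \<alpha> \<alpha>\<beta> by (intro S_chain[OF \<alpha>(1)[of i i0] base(1)]) auto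
    then show ?thesis
      by (simp only: unit_simps base(5))
  qed (use base in blast)
  have 2: "S (\<alpha> i) (\<beta> j) u w" if "i < n" "i \<noteq> j0" "j < n" "i \<noteq> j" for i j
  proof (cases "j = j0")
    case False
    have "S (\<alpha> i) (\<beta> j) (u * u) (w * u)"
      using that False base \<beta> \<alpha>\<beta> by (intro S_chain[OF 1[of i] \<beta>(1)[of j0 j]]) auto
    then show ?thesis
      by (simp only: unit_simps wu)
  qed (use 1 that in blast)
  show ?thesis
  proof (cases "i = j0")
    case True
    \<comment> \<open>The start cannot move to \<open>j0\<close> while the end is attached to
      \<open>j0\<close>. The end is first brought to \<open>j\<close>, with the start at a third
      index \<open>l\<close>, and then the start moves.\<close>
    obtain l where l: "l < n" "l \<noteq> j0" "l \<noteq> j"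
      using ex_third[OF n] by blast
    have "S (\<alpha> i) (\<beta> j) (u * u) (u * w)"
      using True l base ij \<alpha> \<alpha>\<beta> by (intro S_chain[OF \<alpha>(1)[of i l] 2[of l j]]) auto
    then show ?thesis
      by (simp only: unit_simps base(5))
  qed (use 2 ij in blast)
qed

lemma indep_ops:
  assumes "i < n" "j < n" "i \<noteq> j"
  shows "indep n i j" "indep n i (op n j)" "indep n (op n i) j" "indep n (op n i) (op n j)"
  using indep_less[OF assms] by (blast intro: indep_op)+

lemma S_plus_minus:
  assumes "i < n" "j < n" "i \<noteq> j"
  shows "S i (op n j) u p"
proof (rule S_spread[where \<alpha> = "\<lambda>i. i" and \<beta> = "op n" and ?i0.0 = "n - 1" and ?j0.0 = 0])
  show "S (n - 1) (op n 0) u p"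
    using G_gens(1)[of n] n by (simp add: S_def ge_def s_def op_def p_def)
qed (use assms n S_same S_same_op indep_ops p_simps in auto)

lemma S_minus_plus:
  assumes "i < n" "j < n" "i \<noteq> j"
  shows "S (op n i) j u p'"
proof (rule S_spread[where \<alpha> = "op n" and \<beta> = "\<lambda>i. i" and ?i0.0 = 0 and ?j0.0 = "n - 1"])
  show "S (op n 0) (n - 1) u p'"
    using G_gens(2)[of n] n by (simp add: S_def gf_def s'_def op_def p'_def)
qed (use assms n S_same S_same_op indep_ops p_simps in auto)

text \<open>The pairs \<open>(F(p), F(1/p))\<close>, for a polynomial \<open>F\<close>, all lie in the following set. Since the
  values \<open>p k\<close> and \<open>1 / p k\<close> are separated, interpolation isolates a single summand.\<close>

definition R :: "((nat \<Rightarrow> complex) \<times> (nat \<Rightarrow> complex)) set" where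
  "R = {(g, h). \<forall>i<n. \<forall>j<n. i \<noteq> j \<longrightarrow> S i j g h}"

lemma RI: "(\<And>i j. i < n \<Longrightarrow> j < n \<Longrightarrow> i \<noteq> j \<Longrightarrow> S i j g h) \<Longrightarrow> (g, h) \<in> R"
  and RD: "(g, h) \<in> R \<Longrightarrow> i < n \<Longrightarrow> j < n \<Longrightarrow> i \<noteq> j \<Longrightarrow> S i j g h"
  unfolding R_def by blast+

lemma R_unit: "(u, u) \<in> R"
  by (rule RI) (rule S_same)

lemma R_mult:
  assumes "(g, h) \<in> R" "(g', h') \<in> R"
  shows "(g * g', h * h') \<in> R"
proof (rule RI)
  fix i j assume ij: "i < n" "j < n" "i \<noteq> j"
  obtain l where l: "l < n" "l \<noteq> i" "l \<noteq> j"
    using ex_third[OF n] by blast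
  show "S i j (g * g') (h * h')"
    by (rule S_chain[OF RD[OF assms(1)] RD[OF assms(2)], of _ l]) (use l ij indep_ops in auto)
qed

lemma R_linear:
  "(g, h) \<in> R \<Longrightarrow> (g', h') \<in> R \<Longrightarrow> (g + g', h + h') \<in> R"
  "(g, h) \<in> R \<Longrightarrow> (\<lambda>k. c * g k, \<lambda>k. c * h k) \<in> R"
  unfolding R_def using S_linear by blast+

text \<open>The path from \<open>i\<close> to \<open>j\<close> leads through \<open>op n l\<close>.
  Its first leg, a vector of \<open>S_plus_minus\<close> under its other name, has parameters
  \<open>(p, u)\<close>, and its second leg has \<open>(u, p')\<close>.\<close>

lemma R_p: "(p, p') \<in> R"
proof (rule RI)
  fix i j assume ij: "i < n" "j < n" "i \<noteq> j"
  obtain l where l: "l < n" "l \<noteq> i" "l \<noteq> j"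
    using ex_third[OF n] by blast
  have "S (op n (op n i)) (op n l) p u"
    by (rule S_swap[OF S_plus_minus]) (use l ij in auto)
  then have "S i (op n l) p u"
    using ij by simp
  from S_chain[OF this S_minus_plus[of l j]] have "S i j (p * u) (u * p')"
    using l ij indep_ops by auto
  then show "S i j p p'"
    by (simp only: p_simps)
qed

lemma R_interpolate:
  assumes "finite B"
  shows "(\<lambda>k. u k * (\<Prod>c\<in>B. p k - c), \<lambda>k. u k * (\<Prod>c\<in>B. p' k - c)) \<in> R"
  using assms
proof (induction B)
  case empty
  then show ?case using R_unit by simp
next
  case (insert c B)
  have "(p + (\<lambda>k. - c * u k), p' + (\<lambda>k. - c * u k)) \<in> R"
    by (intro R_linear R_p R_unit)
  note R_mult[OF this insert.IH]
  moreover have "(p + (\<lambda>k. - c * u k)) * (\<lambda>k. u k * (\<Prod>c\<in>B. p k - c)) = (\<lambda>k. u k * (\<Prod>c\<in>insert c B. p k - c))"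
      "(p' + (\<lambda>k. - c * u k)) * (\<lambda>k. u k * (\<Prod>c\<in>B. p' k - c)) = (\<lambda>k. u k * (\<Prod>c\<in>insert c B. p' k - c))"
    using insert.hyps by (auto simp: fun_eq_iff u_def)
  ultimately show ?case
    by (simp only:)
qed

end

text \<open>The position \<open>(a, op n a)\<close> is its own partner, so both products land on one
  matrix unit and are subtracted. This is how the weights +-2 eps_x are reached.\<close>

lemma tbr_Y_antipodal:
  assumes "indep n a c"
  shows "tbr (2 * n) (Y n g h a c) (Y n g' h' c (op n a)) =
    E (g * g') a (op n a) - E (h' * h) a (op n a)"
  using assms[THEN indepD(1)] assms[THEN indepD(2)] assms[THEN indepD(3)] assms[THEN indepD(4)]
    assms[THEN indepD(5)] assms[THEN indepD(6)] assms[THEN indepD(7)] assms[THEN indepD(8)]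
    assms[THEN indepD(9)] assms[THEN indepD(10)]
  by (simp add: tbr_def Y_def tmul_linear tmul_E op_neq)

lemma ex_indep:
  assumes "3 \<le> n" "a < 2 * n"
  obtains c where "indep n a c"
proof -
  have "indep n a 0 \<or> indep n a 1"
    using assms by (auto simp: indep_def op_def)
  then show ?thesis
    using that by blast
qed

lemma sum_delta2:
  fixes f :: "nat \<Rightarrow> nat \<Rightarrow> complex"
  shows "(\<Sum>a<N. \<Sum>b<N. f a b * of_bool (i = a \<and> j = b)) = (if i < N \<and> j < N then f i j else 0)"
proof -
  have "(\<Sum>b<N. f a b * of_bool (i = a \<and> j = b)) = (if i = a then if j < N then f i j else 0 else 0)" for a
  proof -
    have "(\<Sum>b<N. f a b * of_bool (i = a \<and> j = b)) = (\<Sum>b<N. if j = b then f a b * of_bool (i = a) else 0)"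
      by (rule sum.cong) auto
    then show ?thesis by simp
  qed
  then show ?thesis by simp
qed

section \<open>Isolating one summand by interpolation\<close>

definition dirac :: "nat \<Rightarrow> complex \<Rightarrow> nat \<Rightarrow> complex" where
  "dirac k0 c = (\<lambda>k. of_bool (k = k0) * c)"

lemma dirac_mult: "dirac k0 c * dirac k0 d = dirac k0 (c * d)"
  by (auto simp: dirac_def fun_eq_iff)

lemma dirac_uminus: "- dirac k0 c = dirac k0 (- c)"
  by (auto simp: dirac_def fun_eq_iff)

context twisted_gen
begin

lemma p_sep: "k \<in> K \<Longrightarrow> l \<in> K \<Longrightarrow> k \<noteq> l \<Longrightarrow> p k \<noteq> p l \<and> p k * p l \<noteq> 1"
  using q_sep[of k l] by (simp add: p_def)

lemma p_inverse: "k \<in> K \<Longrightarrow> p k * p' k = 1"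
  using q_nonzero by (simp add: p_def p'_def r_def)

lemma p'_eq_iff: "k \<in> K \<Longrightarrow> p' k = c \<longleftrightarrow> p k * c = 1"
proof
  assume k: "k \<in> K" and c: "p k * c = 1"
  have "p' k = p' k * (p k * c)"
    unfolding c by simp
  also have "\<dots> = (p k * p' k) * c"
    by (simp only: ac_simps)
  finally show "p' k = c"
    unfolding p_inverse[OF k] by simp
qed (use p_inverse in blast)

text \<open>The second parameter of a root vector whose first is concentrated at \<open>k\<close>.
  It is 0 for generic \<open>p k\<close>, where the two partners separate. If \<open>p k\<close> is
  1 or -1, it is, up to a minus, the sign by which the invariant form ties the entry at
  \<open>(a, b)\<close> to its partner.\<close>

definition coef :: "nat \<Rightarrow> nat \<Rightarrow> nat \<Rightarrow> complex" where
  "coef k a b = of_bool (p k * p k = 1) * (if (a < n) = (b < n) then 1 else p k)"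

lemma S_isolate:
  assumes k0: "k0 \<in> K" and ij: "i < n" "j < n" "i \<noteq> j"
  shows "S i j (dirac k0 1) (dirac k0 (of_bool (p k0 * p k0 = 1)))"
proof -
  \<comment> \<open>The polynomial with these roots vanishes at all values \<open>p k\<close> and
    \<open>p' k\<close> except \<open>p k0\<close>. By separation \<open>p' k = p k0\<close> happens
    only for \<open>k = k0\<close> with \<open>p k0\<close> self-inverse, and exactly then the
    second parameter survives.\<close>
  define B where "B = (p ` K \<union> p' ` K) - {p k0}"
  define D where "D = (\<Prod>c\<in>B. p k0 - c)"
  have "finite B"
    using K by (simp add: B_def)
  moreover have "p k0 - c \<noteq> 0" if "c \<in> B" for c
    using that by (auto simp: B_def)
  ultimately have D: "D \<noteq> 0"
    unfolding D_def by (simp only: prod_zero_iff) blast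
  have at_k0: "1 / D * (u k0 * (\<Prod>c\<in>B. p k0 - c)) = 1"
    using D k0 unfolding D_def[symmetric] by (simp add: u_def)
  have 1: "(\<lambda>k. 1 / D * (u k * (\<Prod>c\<in>B. p k - c))) = dirac k0 1"
  proof
    fix k
    show "1 / D * (u k * (\<Prod>c\<in>B. p k - c)) = dirac k0 1 k"
    proof (cases "k \<in> K \<and> k \<noteq> k0")
      case True
      then have "p k \<in> B"
        using p_sep k0 by (auto simp: B_def)
      then have "(\<Prod>c\<in>B. p k - c) = 0"
        using \<open>finite B\<close> by (intro prod_zero) auto
      then show ?thesis
        using True by (simp add: dirac_def)
    next
      case False
      then consider "k = k0" | "k \<notin> K"
        by blast
      then show ?thesis
      proof cases
        case 1
        then show ?thesis
          using at_k0 by (simp add: dirac_def)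
      next
        case 2
        then show ?thesis
          using k0 by (auto simp: dirac_def u_def)
      qed
    qed
  qed
  have 2: "(\<lambda>k. 1 / D * (u k * (\<Prod>c\<in>B. p' k - c))) = dirac k0 (of_bool (p k0 * p k0 = 1))"
  proof
    fix k
    show "1 / D * (u k * (\<Prod>c\<in>B. p' k - c)) = dirac k0 (of_bool (p k0 * p k0 = 1)) k"
    proof (cases "k \<in> K")
      case True
      show ?thesis
      proof (cases "p' k = p k0")
        case eq: True
        then have "p k * p k0 = 1"
          using p'_eq_iff[OF True] by blast
        then have "k = k0"
          using p_sep[OF True k0] by blast
        then show ?thesis
          using eq at_k0 \<open>p k * p k0 = 1\<close> by (simp add: dirac_def)
      next
        case False
        then have "p' k \<in> B"
          using True by (simp add: B_def)
        then have "(\<Prod>c\<in>B. p' k - c) = 0"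
          using \<open>finite B\<close> by (intro prod_zero) auto
        moreover have "p k0 * p k0 \<noteq> 1" if "k = k0"
          using False p'_eq_iff[OF True] that by blast
        ultimately show ?thesis
          by (auto simp: dirac_def)
      qed
    next
      case False
      then show ?thesis
        using k0 by (auto simp: dirac_def u_def)
    qed
  qed
  have "(dirac k0 1, dirac k0 (of_bool (p k0 * p k0 = 1))) \<in> R"
    using R_linear(2)[OF R_interpolate[OF \<open>finite B\<close>], of "1 / D"] unfolding 1 2 .
  then show ?thesis
    using ij by (rule RD)
qed

lemma dirac_simps:
  assumes "k0 \<in> K"
  shows "u * dirac k0 c = dirac k0 c" "dirac k0 c * u = dirac k0 c"
    "dirac k0 c * p = dirac k0 (p k0 * c)" "p' * dirac k0 c = dirac k0 (p' k0 * c)"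
  using assms by (auto simp: dirac_def fun_eq_iff u_def)

text \<open>Brackets with the vectors of \<open>S_plus_minus\<close> and \<open>S_minus_plus\<close>
  carry the isolated vectors across the halves; each crossing multiplies the second parameter by
  \<open>p k0\<close> or its inverse.\<close>

lemma S_coef:
  assumes k0: "k0 \<in> K" and ab: "indep n a b"
  shows "S a b (dirac k0 1) (dirac k0 (coef k0 a b))"
proof -
  \<comment> \<open>If \<tau> is not 0, then \<open>p k0\<close> is its own inverse; in front of
    \<tau> the factors \<open>p k0\<close> and \<open>p' k0\<close> are therefore
    interchangeable.\<close>
  define \<tau> :: complex where "\<tau> = of_bool (p k0 * p k0 = 1)"
  have p': "p' k0 * \<tau> = p k0 * \<tau>" "p' k0 * (p k0 * \<tau>) = \<tau>"
  proof -
    have "p' k0 = p k0" if "p k0 * p k0 = 1"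
      using that p'_eq_iff[OF k0] by blast
    then show "p' k0 * \<tau> = p k0 * \<tau>" "p' k0 * (p k0 * \<tau>) = \<tau>"
      using p'_eq_iff[OF k0, of "p k0"] unfolding \<tau>_def by (cases "p k0 * p k0 = 1"; simp)+
  qed
  have pp: "S i j (dirac k0 1) (dirac k0 \<tau>)" if "i < n" "j < n" "i \<noteq> j" for i j
    unfolding \<tau>_def using k0 that by (rule S_isolate)
  have pm: "S i (op n j) (dirac k0 1) (dirac k0 (p k0 * \<tau>))" if "i < n" "j < n" "i \<noteq> j" for i j
  proof -
    obtain l where l: "l < n" "l \<noteq> i" "l \<noteq> j"
      using ex_third[OF n] by blast
    have "S i (op n j) (dirac k0 1 * u) (dirac k0 \<tau> * p)"
      by (rule S_chain[OF pp S_plus_minus, of _ l]) (use l that indep_ops in auto)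
    then show ?thesis
      by (simp only: dirac_simps[OF k0])
  qed
  have mp: "S (op n i) j (dirac k0 1) (dirac k0 (p k0 * \<tau>))" if "i < n" "j < n" "i \<noteq> j" for i j
  proof -
    obtain l where l: "l < n" "l \<noteq> i" "l \<noteq> j"
      using ex_third[OF n] by blast
    have "S (op n i) j (u * dirac k0 1) (p' * dirac k0 \<tau>)"
      by (rule S_chain[OF S_minus_plus pp, of _ l]) (use l that indep_ops in auto)
    then show ?thesis
      by (simp only: dirac_simps[OF k0] p')
  qed
  have mm: "S (op n i) (op n j) (dirac k0 1) (dirac k0 \<tau>)" if "i < n" "j < n" "i \<noteq> j" for i j
  proof -
    obtain l where l: "l < n" "l \<noteq> i" "l \<noteq> j"
      using ex_third[OF n] by blast
    have "S (op n i) (op n j) (u * dirac k0 1) (p' * dirac k0 (p k0 * \<tau>))"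
      by (rule S_chain[OF S_minus_plus pm, of _ l]) (use l that indep_ops in auto)
    then show ?thesis
      by (simp only: dirac_simps[OF k0] p')
  qed
  have large: "op n a < n \<and> op n (op n a) = a" if "a < 2 * n" "\<not> a < n" for a
    using that by (auto simp: op_def)
  have lt: "a < 2 * n" "b < 2 * n" "a \<noteq> b" "a \<noteq> op n b" "op n a \<noteq> b" "op n a \<noteq> op n b"
    using indepD[OF ab] by blast+
  consider "a < n" "b < n" | "a < n" "\<not> b < n" | "\<not> a < n" "b < n" | "\<not> a < n" "\<not> b < n"
    by blast
  then show ?thesis
  proof cases
    case 1
    then have "coef k0 a b = \<tau>"
      by (simp add: coef_def \<tau>_def)
    then show ?thesis
      using pp 1 lt by metis
  next
    case 2
    then have "coef k0 a b = p k0 * \<tau>"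
      by (simp add: coef_def \<tau>_def)
    then show ?thesis
      using pm[of a "op n b"] large[of b] 2 lt by metis
  next
    case 3
    then have "coef k0 a b = p k0 * \<tau>"
      by (simp add: coef_def \<tau>_def)
    then show ?thesis
      using mp[of "op n a" b] large[of a] 3 lt by metis
  next
    case 4
    then have "coef k0 a b = \<tau>"
      by (simp add: coef_def \<tau>_def)
    then show ?thesis
      using mm[of "op n a" "op n b"] large[of a] large[of b] 4 lt by metis
  qed
qed

lemma sl_summand:
  assumes k0: "k0 \<in> K" and generic: "p k0 * p k0 \<noteq> 1"
    and supp: "\<And>k i j. k \<noteq> k0 \<or> 2 * n \<le> i \<or> 2 * n \<le> j \<Longrightarrow> x k i j = 0"
    and trace: "(\<Sum>i<2 * n. x k0 i i) = 0"
  shows "x \<in> G"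
proof -
  let ?E = "E (dirac k0 1)"
  \<comment> \<open>The second parameter vanishes, so one half of the root vector remains: a single
    matrix unit.\<close>
  have indep: "?E a b \<in> G" if "indep n a b" for a b
  proof -
    have "dirac k0 (- coef k0 a b) = 0"
      using generic by (simp add: coef_def dirac_def fun_eq_iff)
    then show ?thesis
      using S_coef[OF k0 that] by (simp add: S_def dirac_uminus Y_def E_linear)
  qed
  have off: "?E a b \<in> G" if ab: "a < 2 * n" "b < 2 * n" "a \<noteq> b" for a b
  proof (cases "b = op n a")
    case False
    then show ?thesis
      using ab op_simps(2)[of b n] by (intro indep) (auto simp: indep_def)
  next
    case True
    obtain c where c: "indep n a c"
      using ex_indep[OF n ab(1)] .
    then have c': "indep n c (op n a)"
      by (blast intro: indep_op indep_sym)
    have "br (?E a c) (?E c (op n a)) = ?E a (op n a)"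
      using indepD[OF c] ab op_neq[of a n] by (simp add: tbr_def tmul_E dirac_mult)
    then show ?thesis
      using G_br[OF indep[OF c] indep[OF c']] True by simp
  qed
  have diag: "?E a a - ?E b b \<in> G" if ab: "a < 2 * n" "b < 2 * n" for a b
  proof (cases "a = b")
    case True
    then show ?thesis using G_zero by simp
  next
    case False
    then have "br (?E a b) (?E b a) = ?E a a - ?E b b"
      using ab by (simp add: tbr_def tmul_E dirac_mult)
    then show ?thesis
      using G_br[OF off[of a b] off[of b a]] ab False by simp
  qed
  \<comment> \<open>Subtracting the unit at \<open>(0, 0)\<close> turns diagonal terms into
    differences. Over all terms the correction adds up to the trace times that unit, which is
    0.\<close>
  define f where "f a b = tscale (x k0 a b) (?E a b - (if a = b then ?E 0 0 else 0))" for a b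
  have "f a b \<in> G" if "a < 2 * n" "b < 2 * n" for a b
  proof (cases "a = b")
    case True
    then show ?thesis
      using G_scale[OF diag[of a 0]] that by (simp add: f_def)
  next
    case False
    then show ?thesis
      using G_scale[OF off[of a b]] that by (simp add: f_def)
  qed
  then have "(\<Sum>a<2 * n. \<Sum>b<2 * n. f a b) \<in> G"
    by (intro G_sum) auto
  moreover have "(\<Sum>a<2 * n. \<Sum>b<2 * n. f a b) k i j = x k i j" for k i j
  proof -
    have "f a b k i j = of_bool (k = k0) * (x k0 a b * of_bool (i = a \<and> j = b))
        - of_bool (k = k0 \<and> i = 0 \<and> j = 0) * (x k0 a b * of_bool (a = b))" for a b
      by (auto simp: f_def tscale_def E_def dirac_def)
    moreover have "(\<Sum>a<2 * n. \<Sum>b<2 * n. x k0 a b * of_bool (a = b)) = 0"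
    proof -
      have "(\<Sum>b<2 * n. x k0 a b * of_bool (a = b)) = x k0 a a" if "a < 2 * n" for a
      proof -
        have "(\<Sum>b<2 * n. x k0 a b * of_bool (a = b)) = (\<Sum>b<2 * n. if a = b then x k0 a b else 0)"
          by (rule sum.cong) auto
        then show ?thesis using that by simp
      qed
      then have "(\<Sum>a<2 * n. \<Sum>b<2 * n. x k0 a b * of_bool (a = b)) = (\<Sum>a<2 * n. x k0 a a)"
        by (intro sum.cong) auto
      then show ?thesis
        unfolding trace .
    qed
    ultimately have "(\<Sum>a<2 * n. \<Sum>b<2 * n. f a b) k i j =
        of_bool (k = k0) * (if i < 2 * n \<and> j < 2 * n then x k0 i j else 0)"
      by (simp only: sum_tup_apply sum_subtractf sum_distrib_left[symmetric] sum_delta2) simp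
    then show ?thesis
      using supp[of k i j] by auto
  qed
  ultimately show ?thesis
    by (metis (no_types, lifting) ext)
qed

lemma form_summand:
  assumes k0: "k0 \<in> K" and special: "p k0 * p k0 = 1"
    and supp: "\<And>k i j. k \<noteq> k0 \<or> 2 * n \<le> i \<or> 2 * n \<le> j \<Longrightarrow> x k i j = 0"
    and form: "\<And>i j. i < 2 * n \<Longrightarrow> j < 2 * n \<Longrightarrow> x k0 (op n j) (op n i) = - coef k0 i j * x k0 i j"
  shows "x \<in> G"
proof -
  let ?E = "E (dirac k0 1)" and ?t = "coef k0"
  define Z where "Z a b = Y n (dirac k0 1) (dirac k0 (- ?t a b)) a b" for a b
  have op_half: "op n a < n \<longleftrightarrow> \<not> a < n" if "a < 2 * n" for a
    using that by (auto simp: op_def)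
  have t: "?t a b * ?t b a = 1" "?t a b * ?t a b = 1" for a b
    using special by (auto simp: coef_def)
  have t_op: "?t (op n b) (op n a) = ?t a b" if "a < 2 * n" "b < 2 * n" for a b
    using that op_half by (auto simp: coef_def)
  have indep: "Z a b \<in> G" if "indep n a b" for a b
    using S_coef[OF k0 that] by (simp add: Z_def S_def dirac_uminus)
  have H: "H n (dirac k0 1) a c \<in> G" if c: "indep n a c" for a c
  proof -
    have "br (Z a c) (Z c a) = H n (dirac k0 1) a c"
      unfolding Z_def by (rule tbr_Y_opposite[OF c]) (simp_all add: dirac_mult t)
    then show ?thesis
      using G_br[OF indep[OF c] indep[OF indep_sym[OF c]]] by simp
  qed
  have Z: "Z a b \<in> G" if ab: "a < 2 * n" "b < 2 * n" for a b
  proof -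
    obtain c where c: "indep n a c"
      using ex_indep[OF n ab(1)] .
    consider "b = a" | "b = op n a" | "indep n a b"
      using ab op_simps(2)[of b n] unfolding indep_def by metis
    then show ?thesis
    proof cases
      case 1
      \<comment> \<open>The parts at \<open>c\<close> and \<open>op n c\<close> cancel, leaving
        twice the diagonal vector at \<open>a\<close>.\<close>
      have "H n (dirac k0 1) a c + H n (dirac k0 1) a (op n c) \<in> G"
        using H c indep_op(2)[OF c] by (intro G_plus)
      moreover have "H n (dirac k0 1) a c + H n (dirac k0 1) a (op n c) = Z a a + Z a a"
      proof -
        have "coef k0 a a = 1"
          using special by (simp add: coef_def)
        then have "Z a a = ?E a a - ?E (op n a) (op n a)"
          by (simp add: Z_def Y_def dirac_uminus[symmetric] E_linear)
        then show ?thesis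
          using indepD(2)[OF c] by (simp add: H_def)
      qed
      moreover have "tscale (1 / 2) (z + z) = z" for z
        by (simp add: tscale_def fun_eq_iff)
      ultimately show ?thesis
        using G_scale[of "Z a a + Z a a" "1 / 2"] 1 by simp
    next
      case 2
      have c': "indep n c (op n a)"
        using c by (blast intro: indep_op indep_sym)
      have "?t c (op n a) * ?t a c = p k0"
        using special op_half[OF ab(1)] by (auto simp: coef_def)
      \<comment> \<open>The result is \<open>1 - p k0\<close> times a matrix unit: zero in the
        orthogonal case and twice the unit in the symplectic one.\<close>
      then have "br (Z a c) (Z c (op n a)) = E (dirac k0 1) a (op n a) - E (dirac k0 (p k0)) a (op n a)"
        unfolding Z_def tbr_Y_antipodal[OF c] by (simp add: dirac_mult)
      also have "\<dots> = Z a b"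
      proof -
        have "coef k0 a (op n a) = p k0"
          using special op_half[OF ab(1)] by (simp add: coef_def)
        then show ?thesis
          using 2 ab(1) by (simp add: Z_def Y_def dirac_uminus[symmetric] E_linear)
      qed
      finally show ?thesis
        using G_br[OF indep[OF c] indep[OF c']] by simp
    qed (rule indep)
  qed
  \<comment> \<open>Each entry is reached from \<open>(a, b)\<close> and from the partner
    \<open>(op n b, op n a)\<close>; by \<open>form\<close> both contributions are equal, whence the
    factor 1/2.\<close>
  define f where "f a b = tscale (x k0 a b / 2) (Z a b)" for a b
  have "(\<Sum>a<2 * n. \<Sum>b<2 * n. f a b) \<in> G"
    unfolding f_def by (intro G_sum G_scale Z) auto
  moreover have "(\<Sum>a<2 * n. \<Sum>b<2 * n. f a b) k i j = x k i j" for k i j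
  proof (cases "k = k0 \<and> i < 2 * n \<and> j < 2 * n")
    case True
    have "f a b k i j = 1 / 2 * (x k0 a b * of_bool (i = a \<and> j = b))
        + 1 / 2 * (- ?t a b * x k0 a b * of_bool (op n j = a \<and> op n i = b))"
      if "a < 2 * n" "b < 2 * n" for a b
    proof -
      have "i = op n b \<and> j = op n a \<longleftrightarrow> op n j = a \<and> op n i = b"
        using True that by auto
      then show ?thesis
        using True by (auto simp: f_def tscale_def Z_def Y_def E_def dirac_def algebra_simps)
    qed
    then have "(\<Sum>a<2 * n. \<Sum>b<2 * n. f a b) k i j =
       (\<Sum>a<2 * n. \<Sum>b<2 * n. 1 / 2 * (x k0 a b * of_bool (i = a \<and> j = b))
        + 1 / 2 * (- ?t a b * x k0 a b * of_bool (op n j = a \<and> op n i = b)))"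
      unfolding sum_tup_apply by (intro sum.cong) auto
    also have "\<dots> = 1 / 2 * x k0 i j + 1 / 2 * (- ?t (op n j) (op n i) * x k0 (op n j) (op n i))"
      using True by (simp only: sum.distrib sum_distrib_left[symmetric] sum_delta2 op_simps) simp
    also have "\<dots> = x k i j"
    proof -
      have "x k0 (op n j) (op n i) = - ?t i j * x k0 i j" "?t (op n j) (op n i) = ?t i j"
        using True form t_op by blast+
      then have "- ?t (op n j) (op n i) * x k0 (op n j) (op n i) = (?t i j * ?t i j) * x k0 i j"
        by (simp only: mult_minus_left mult_minus_right minus_minus mult.assoc)
      also have "\<dots> = x k0 i j"
        unfolding t(2) by (rule mult_1_left)
      finally have "- ?t (op n j) (op n i) * x k0 (op n j) (op n i) = x k0 i j" .
      then show ?thesis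
        using True by (simp only:) simp
    qed
    finally show ?thesis .
  next
    case False
    then have "E (dirac k0 v) a b k i j = 0" if "a < 2 * n" "b < 2 * n" for v a b
      using that by (auto simp: E_def dirac_def)
    then have "f a b k i j = 0" if "a < 2 * n" "b < 2 * n" for a b
      using that by (simp add: f_def tscale_def Z_def Y_def)
    then show ?thesis
      using supp[of k i j] False by (auto simp: sum_tup_apply)
  qed
  ultimately show ?thesis
    by (metis (no_types, lifting) ext)
qed

theorem G_complete:
  assumes supp: "\<And>k i j. k \<notin> K \<or> 2 * n \<le> i \<or> 2 * n \<le> j \<Longrightarrow> x k i j = 0"
    and trace: "\<And>k. k \<in> K \<Longrightarrow> p k * p k \<noteq> 1 \<Longrightarrow> (\<Sum>i<2 * n. x k i i) = 0"
    and form: "\<And>k i j. k \<in> K \<Longrightarrow> p k * p k = 1 \<Longrightarrow> i < 2 * n \<Longrightarrow> j < 2 * n \<Longrightarrow>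
      x k (op n j) (op n i) = - coef k i j * x k i j"
  shows "x \<in> G"
proof -
  define f :: "nat \<Rightarrow> tup" where "f k0 = (\<lambda>k i j. if k = k0 then x k i j else 0)" for k0
  have "f k0 \<in> G" if k0: "k0 \<in> K" for k0
  proof (cases "p k0 * p k0 = 1")
    case True
    show ?thesis
      by (rule form_summand[OF k0 True]) (use supp form k0 True in \<open>auto simp: f_def\<close>)
  next
    case False
    show ?thesis
      by (rule sl_summand[OF k0 False]) (use supp trace k0 False in \<open>auto simp: f_def\<close>)
  qed
  then have "(\<Sum>k0\<in>K. f k0) \<in> G"
    by (rule G_sum)
  moreover have "(\<Sum>k0\<in>K. f k0) k i j = x k i j" for k i j
    using K supp[of k i j] by (auto simp: sum_tup_apply f_def)
  ultimately show ?thesis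
    by (metis (no_types, lifting) ext)
qed

end

section \<open>From the split to the skew-symmetric orthogonal algebra\<close>

text \<open>For the sum of squares every row below \<open>2 * n\<close> is isotropic, and row
  \<open>a\<close> pairs only with row \<open>op n a\<close>, with value 1/2. The rows are thus a
  split basis for the form whose algebra is that of skew-symmetric matrices.\<close>

definition Qm :: "nat \<Rightarrow> nat \<Rightarrow> nat \<Rightarrow> complex" where
  "Qm n i m = (if i < n then 1 / 2 * of_bool (m = i) - \<i> / 2 * of_bool (m = i + n)
     else if i < 2 * n then 1 / 2 * of_bool (m = i - n) + \<i> / 2 * of_bool (m = i) else 0)"

text \<open>The inverse of \<open>Qm n\<close> is twice its transpose, with rows permuted by \<open>op n\<close>.\<close>

definition Pm :: "nat \<Rightarrow> nat \<Rightarrow> nat \<Rightarrow> complex" where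
  "Pm n i j = (if j < 2 * n then 2 * Qm n (op n j) i else 0)"

lemma sum_two:
  fixes g :: "nat \<Rightarrow> complex"
  assumes "x < N" "y < N"
  shows "(\<Sum>m<N. (A * of_bool (m = x) + B * of_bool (m = y)) * g m) = A * g x + B * g y"
proof -
  have "(\<Sum>m<N. (A * of_bool (m = x) + B * of_bool (m = y)) * g m) =
      (\<Sum>m<N. (if x = m then A * g m else 0)) + (\<Sum>m<N. (if y = m then B * g m else 0))"
    unfolding sum.distrib[symmetric] by (rule sum.cong) (auto simp: algebra_simps)
  then show ?thesis
    using assms by simp
qed

lemma sum_Qm_row:
  assumes "i < 2 * n"
  shows "(\<Sum>m<2 * n. Qm n i m * g m) =
    (if i < n then 1 / 2 * g i - \<i> / 2 * g (i + n) else 1 / 2 * g (i - n) + \<i> / 2 * g i)"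
proof (cases "i < n")
  case True
  have "(\<Sum>m<2 * n. Qm n i m * g m) =
      (\<Sum>m<2 * n. (1 / 2 * of_bool (m = i) + (- \<i> / 2) * of_bool (m = i + n)) * g m)"
    using True by (intro sum.cong) (simp_all add: Qm_def)
  also have "\<dots> = 1 / 2 * g i + (- \<i> / 2) * g (i + n)"
    by (rule sum_two) (use True in auto)
  finally show ?thesis
    using True by simp
next
  case False
  have "(\<Sum>m<2 * n. Qm n i m * g m) =
      (\<Sum>m<2 * n. (1 / 2 * of_bool (m = i - n) + \<i> / 2 * of_bool (m = i)) * g m)"
    using False assms by (intro sum.cong) (simp_all add: Qm_def)
  also have "\<dots> = 1 / 2 * g (i - n) + \<i> / 2 * g i"
    by (rule sum_two) (use assms in auto)
  finally show ?thesis
    using False by simp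
qed

lemma sum_Qm_col:
  assumes "i < 2 * n"
  shows "(\<Sum>l<2 * n. Qm n l i * g l) =
    (if i < n then 1 / 2 * g i + 1 / 2 * g (i + n) else - \<i> / 2 * g (i - n) + \<i> / 2 * g i)"
proof (cases "i < n")
  case True
  have "(\<Sum>l<2 * n. Qm n l i * g l) =
      (\<Sum>l<2 * n. (1 / 2 * of_bool (l = i) + 1 / 2 * of_bool (l = i + n)) * g l)"
    using True by (intro sum.cong) (auto simp: Qm_def)
  also have "\<dots> = 1 / 2 * g i + 1 / 2 * g (i + n)"
    by (rule sum_two) (use True in auto)
  finally show ?thesis
    using True by simp
next
  case False
  have "(\<Sum>l<2 * n. Qm n l i * g l) =
      (\<Sum>l<2 * n. (- \<i> / 2 * of_bool (l = i - n) + \<i> / 2 * of_bool (l = i)) * g l)"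
    using False assms by (intro sum.cong) (auto simp: Qm_def)
  also have "\<dots> = - \<i> / 2 * g (i - n) + \<i> / 2 * g i"
    by (rule sum_two) (use assms in auto)
  finally show ?thesis
    using False by simp
qed

lemma Qm_Pm:
  assumes "i < 2 * n" "j < 2 * n"
  shows "(\<Sum>m<2 * n. Qm n i m * Pm n m j) = of_bool (i = j)"
proof (cases "i < n"; cases "j < n")
  assume "i < n" "j < n"
  then show ?thesis
    unfolding sum_Qm_row[OF assms(1)] using assms by (cases "i = j") (auto simp: Pm_def Qm_def op_def)
next
  assume "i < n" "\<not> j < n"
  then show ?thesis
    unfolding sum_Qm_row[OF assms(1)] using assms by (cases "i = j - n") (auto simp: Pm_def Qm_def op_def)
next
  assume "\<not> i < n" "j < n"
  then show ?thesis
    unfolding sum_Qm_row[OF assms(1)] using assms by (cases "j = i - n") (auto simp: Pm_def Qm_def op_def)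
next
  assume "\<not> i < n" "\<not> j < n"
  then show ?thesis
    unfolding sum_Qm_row[OF assms(1)] using assms by (cases "i = j") (auto simp: Pm_def Qm_def op_def)
qed

lemma Pm_Qm:
  assumes "i < 2 * n" "j < 2 * n"
  shows "(\<Sum>m<2 * n. Pm n i m * Qm n m j) = of_bool (i = j)"
proof -
  have "(\<Sum>m<2 * n. Pm n i m * Qm n m j) = (\<Sum>m<2 * n. Qm n m j * Pm n i m)"
    by (simp only: mult.commute)
  also have "\<dots> = of_bool (i = j)"
  proof (cases "i < n"; cases "j < n")
    assume "i < n" "j < n"
    then show ?thesis
      unfolding sum_Qm_col[OF assms(2)] using assms by (cases "i = j") (auto simp: Pm_def Qm_def op_def)
  next
    assume "i < n" "\<not> j < n"
    then show ?thesis
      unfolding sum_Qm_col[OF assms(2)] using assms by (cases "i = j - n") (auto simp: Pm_def Qm_def op_def)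
  next
    assume "\<not> i < n" "j < n"
    then show ?thesis
      unfolding sum_Qm_col[OF assms(2)] using assms by (cases "j = i - n") (auto simp: Pm_def Qm_def op_def)
  next
    assume "\<not> i < n" "\<not> j < n"
    then show ?thesis
      unfolding sum_Qm_col[OF assms(2)] using assms by (cases "i = j") (auto simp: Pm_def Qm_def op_def)
  qed
  finally show ?thesis .
qed

section \<open>Conjugating the orthogonal blocks of a tuple\<close>

definition supp :: "nat \<Rightarrow> tup \<Rightarrow> bool" where
  "supp N x \<longleftrightarrow> (\<forall>k i j. N \<le> i \<or> N \<le> j \<longrightarrow> x k i j = 0)"

definition idt :: "nat \<Rightarrow> tup" where
  "idt N = (\<lambda>k i j. of_bool (i = j \<and> i < N))"

lemma tmul_idt_left: "row_bounded N x \<Longrightarrow> tmul N (idt N) x = x"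
proof -
  assume x: "row_bounded N x"
  have "(\<Sum>l<N. idt N k i l * x k l j) = x k i j" for k i j
  proof (cases "i < N")
    case True
    have "(\<Sum>l<N. idt N k i l * x k l j) = (\<Sum>l<N. if i = l then x k l j else 0)"
      by (rule sum.cong) (auto simp: idt_def)
    then show ?thesis
      using True by simp
  next
    case False
    then show ?thesis
      using x by (simp add: idt_def row_bounded_def)
  qed
  then show ?thesis
    by (simp add: tmul_def)
qed

lemma tmul_idt_right: "(\<And>k i j. N \<le> j \<Longrightarrow> x k i j = 0) \<Longrightarrow> tmul N x (idt N) = x"
proof -
  assume x: "\<And>k i j. N \<le> j \<Longrightarrow> x k i j = 0"
  have "(\<Sum>l<N. x k i l * idt N k l j) = x k i j" for k i j
  proof (cases "j < N")
    case True
    have "(\<Sum>l<N. x k i l * idt N k l j) = (\<Sum>l<N. if j = l then x k i l else 0)"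
      by (rule sum.cong) (auto simp: idt_def)
    then show ?thesis
      using True by simp
  next
    case False
    then have "(\<Sum>l<N. x k i l * idt N k l j) = 0"
      by (intro sum.neutral) (auto simp: idt_def)
    then show ?thesis
      using x[of j k i] False by simp
  qed
  then show ?thesis
    by (simp add: tmul_def)
qed

text \<open>With \<open>m = a + c\<close> the base change leaves the special linear and symplectic
  blocks alone, and a single conjugation serves the whole tuple.\<close>

definition Qt :: "nat \<Rightarrow> nat \<Rightarrow> tup" where
  "Qt n m = (\<lambda>k. if m \<le> k then Qm n else idt (2 * n) k)"

definition Pt :: "nat \<Rightarrow> nat \<Rightarrow> tup" where
  "Pt n m = (\<lambda>k. if m \<le> k then Pm n else idt (2 * n) k)"

lemma Qm_zero: "2 * n \<le> i \<or> 2 * n \<le> j \<Longrightarrow> Qm n i j = 0"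
  by (auto simp: Qm_def)

lemma supp_Qt: "supp (2 * n) (Qt n m)" and supp_Pt: "supp (2 * n) (Pt n m)"
  using Qm_zero[of n] by (auto simp: supp_def Qt_def Pt_def idt_def Pm_def)

lemma supp_row: "supp N x \<Longrightarrow> row_bounded N x"
  and supp_col: "supp N x \<Longrightarrow> N \<le> j \<Longrightarrow> x k i j = 0"
  by (auto simp: supp_def row_bounded_def)

lemma supp_tmul: "supp N x \<Longrightarrow> supp N y \<Longrightarrow> supp N (tmul N x y)"
  by (auto simp: supp_def tmul_def)

lemma Qt_Pt: "tmul (2 * n) (Qt n m) (Pt n m) = idt (2 * n)"
  and Pt_Qt: "tmul (2 * n) (Pt n m) (Qt n m) = idt (2 * n)"
proof -
  have id: "tmul (2 * n) (idt (2 * n)) (idt (2 * n)) = idt (2 * n)"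
    by (rule tmul_idt_left) (auto simp: row_bounded_def idt_def)
  have *: "tmul (2 * n) x y = idt (2 * n)"
    if "supp (2 * n) x" "supp (2 * n) y" and xy: "\<And>k i j. i < 2 * n \<Longrightarrow> j < 2 * n \<Longrightarrow>
      tmul (2 * n) x y k i j = of_bool (i = j)" for x y
  proof (intro ext)
    fix k i j
    show "tmul (2 * n) x y k i j = idt (2 * n) k i j"
    proof (cases "i < 2 * n \<and> j < 2 * n")
      case True
      then show ?thesis
        using xy by (simp add: idt_def)
    next
      case False
      then show ?thesis
        using supp_tmul[OF that(1,2)] unfolding supp_def idt_def by auto
    qed
  qed
  have low: "tmul (2 * n) x y k i j = of_bool (i = j)"
    if "x k = idt (2 * n) k" "y k = idt (2 * n) k" "i < 2 * n" for x y k i j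
    using that fun_cong[OF fun_cong[OF fun_cong[OF id]], of k i j] by (simp add: tmul_def idt_def)
  show "tmul (2 * n) (Qt n m) (Pt n m) = idt (2 * n)"
  proof (rule *[OF supp_Qt supp_Pt])
    fix k i j assume "i < 2 * n" "j < 2 * n"
    then show "tmul (2 * n) (Qt n m) (Pt n m) k i j = of_bool (i = j)"
      using low[of "Qt n m" k "Pt n m" i j] Qm_Pm by (cases "m \<le> k") (simp_all add: tmul_def Qt_def Pt_def)
  qed
  show "tmul (2 * n) (Pt n m) (Qt n m) = idt (2 * n)"
  proof (rule *[OF supp_Pt supp_Qt])
    fix k i j assume "i < 2 * n" "j < 2 * n"
    then show "tmul (2 * n) (Pt n m) (Qt n m) k i j = of_bool (i = j)"
      using low[of "Pt n m" k "Qt n m" i j] Pm_Qm by (cases "m \<le> k") (simp_all add: tmul_def Qt_def Pt_def)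
  qed
qed

definition cj :: "nat \<Rightarrow> nat \<Rightarrow> tup \<Rightarrow> tup" where
  "cj n m x = tmul (2 * n) (tmul (2 * n) (Pt n m) x) (Qt n m)"

definition cj' :: "nat \<Rightarrow> nat \<Rightarrow> tup \<Rightarrow> tup" where
  "cj' n m x = tmul (2 * n) (tmul (2 * n) (Qt n m) x) (Pt n m)"

lemma cj_linear:
  "cj n m (x + y) = cj n m x + cj n m y"
  "cj n m (x - y) = cj n m x - cj n m y"
  "cj n m (tscale a x) = tscale a (cj n m x)"
  by (simp_all add: cj_def tmul_linear)

lemma supp_cj: "supp (2 * n) x \<Longrightarrow> supp (2 * n) (cj n m x)" "supp (2 * n) x \<Longrightarrow> supp (2 * n) (cj' n m x)"
  unfolding cj_def cj'_def by (intro supp_tmul supp_Qt supp_Pt; assumption)+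

lemma Qt_Pt_cancel:
  assumes "supp (2 * n) x"
  shows "tmul (2 * n) (Qt n m) (tmul (2 * n) (Pt n m) x) = x"
    and "tmul (2 * n) (Pt n m) (tmul (2 * n) (Qt n m) x) = x"
  using tmul_idt_left[OF supp_row[OF assms]]
  by (simp_all only: tmul_assoc[symmetric] Qt_Pt Pt_Qt)

lemma cj_tmul:
  assumes "supp (2 * n) x" "supp (2 * n) y"
  shows "tmul (2 * n) (cj n m x) (cj n m y) = cj n m (tmul (2 * n) x y)"
  unfolding cj_def tmul_assoc
  by (simp only: Qt_Pt_cancel[OF supp_tmul[OF assms(2) supp_Qt]])

lemma cj_tbr:
  assumes "supp (2 * n) x" "supp (2 * n) y"
  shows "cj n m (tbr (2 * n) x y) = tbr (2 * n) (cj n m x) (cj n m y)"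
  unfolding tbr_def cj_linear cj_tmul[OF assms] cj_tmul[OF assms(2,1)] ..

lemma cj_cj':
  assumes "supp (2 * n) x"
  shows "cj n m (cj' n m x) = x"
proof -
  have "tmul (2 * n) x (idt (2 * n)) = x"
    using supp_col[OF assms] by (intro tmul_idt_right)
  then show ?thesis
    unfolding cj_def cj'_def tmul_assoc Pt_Qt by (simp only: Qt_Pt_cancel[OF assms])
qed

lemma cj_below:
  assumes "supp (2 * n) x" "k < m"
  shows "cj n m x k = x k" "cj' n m x k = x k"
proof -
  let ?i = "idt (2 * n)"
  have "tmul (2 * n) (tmul (2 * n) ?i x) ?i = x"
    using supp_col[OF assms(1)] tmul_idt_left[OF supp_row[OF assms(1)]]
    by (simp only: tmul_idt_right)
  then have "tmul (2 * n) (tmul (2 * n) ?i x) ?i k = x k"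
    by simp
  then show "cj n m x k = x k" "cj' n m x k = x k"
    using assms(2) by (simp_all add: cj_def cj'_def tmul_def Qt_def Pt_def)
qed

lemma sum_op: "(\<Sum>i<2 * n. f (op n i)) = (\<Sum>i<2 * n. f i)"
  by (rule sum.reindex_bij_witness[of _ "op n" "op n"]) auto

text \<open>\<open>Pm\<close> is twice the transpose of the row-permuted \<open>Qm\<close>.
  Reindexing both sums by \<open>op n\<close> therefore turns transposition of the conjugate into
  the twisted transposition of \<open>x\<close>.\<close>

lemma cj_skew:
  assumes k: "m \<le> k"
    and x: "\<And>i j. i < 2 * n \<Longrightarrow> j < 2 * n \<Longrightarrow> x k (op n j) (op n i) = - x k i j"
  shows "cj n m x k j i = - cj n m x k i j"
proof -
  have eq: "cj n m x k i j = (\<Sum>l<2 * n. \<Sum>s<2 * n. 2 * Qm n (op n s) i * x k s l * Qm n l j)" for i j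
    using k by (simp add: cj_def tmul_def Pt_def Qt_def Pm_def sum_distrib_right)
  have "cj n m x k j i =
      (\<Sum>l<2 * n. \<Sum>s<2 * n. 2 * Qm n (op n (op n s)) j * x k (op n s) (op n l) * Qm n (op n l) i)"
    unfolding eq by (subst sum_op[symmetric], subst (2) sum_op[symmetric]) (rule refl)
  also have "\<dots> = (\<Sum>l<2 * n. \<Sum>s<2 * n. - (2 * Qm n (op n l) i * x k l s * Qm n s j))"
    by (intro sum.cong refl) (simp add: x)
  also have "\<dots> = - cj n m x k i j"
    unfolding eq sum_negf by (subst sum.swap) (rule refl)
  finally show ?thesis .
qed

lemma cj'_skew:
  assumes k: "m \<le> k" and x: "\<And>i j. x k j i = - x k i j" and ij: "i < 2 * n" "j < 2 * n"
  shows "cj' n m x k (op n j) (op n i) = - cj' n m x k i j"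
proof -
  have eq: "cj' n m x k i j = (\<Sum>l<2 * n. \<Sum>s<2 * n. 2 * Qm n i s * x k s l * Qm n (op n j) l)"
    if "j < 2 * n" for i j
    using k that by (simp add: cj'_def tmul_def Pt_def Qt_def Pm_def sum_distrib_right mult_ac)
  have "cj' n m x k (op n j) (op n i) =
      (\<Sum>l<2 * n. \<Sum>s<2 * n. 2 * Qm n (op n j) s * x k s l * Qm n i l)"
    using ij by (simp add: eq)
  also have "\<dots> = (\<Sum>s<2 * n. \<Sum>l<2 * n. - (2 * Qm n i l * x k l s * Qm n (op n j) s))"
    by (subst sum.swap, intro sum.cong refl) (subst x, simp add: mult_ac)
  also have "\<dots> = - cj' n m x k i j"
    unfolding eq[OF ij(2)] sum_negf ..
  finally show ?thesis .
qed

section \<open>The direct sum\<close>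

lemma M_sum_sel:
  "zer (M_sum n a c d) = 0"
  "pls (M_sum n a c d) x y = x + y"
  "scl (M_sum n a c d) t x = tscale t x"
  "brk (M_sum n a c d) x y = tbr (2 * n) x y"
  by (auto simp: M_sum_def dsum_def sl_lie_def sp_lie_def so_lie_def mat_lie_def fun_eq_iff
      tscale_def tbr_def tmul_def sum_subtractf)

text \<open>\<open>Jmat n\<close> is the permutation \<open>op n\<close> with signs, so each sum has
  one term. Replacing \<open>i\<close> by \<open>op n i\<close> brings the condition into the shape
  of \<open>form_summand\<close>.\<close>

lemma sp_condition:
  "(\<forall>i<2 * n. \<forall>j<2 * n. (\<Sum>k<2 * n. X k i * Jmat n k j) + (\<Sum>k<2 * n. Jmat n i k * X k j) = 0) \<longleftrightarrow>
   (\<forall>i<2 * n. \<forall>j<2 * n. X (op n j) (op n i) = - (if (i < n) = (j < n) then 1 else - 1) * X i j)"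
  (is "?L \<longleftrightarrow> ?R")
proof -
  define sg :: "nat \<Rightarrow> complex" where "sg i = (if i < n then 1 else - 1)" for i
  have 1: "(\<Sum>k<2 * n. X k i * Jmat n k j) = - sg j * X (op n j) i" if "j < 2 * n" for i j
  proof -
    have "(\<Sum>k<2 * n. X k i * Jmat n k j) = (\<Sum>k<2 * n. if op n j = k then - sg j * X k i else 0)"
      using that by (intro sum.cong) (auto simp: Jmat_def op_def sg_def)
    then show ?thesis
      using that by simp
  qed
  have 2: "(\<Sum>k<2 * n. Jmat n i k * X k j) = sg i * X (op n i) j" if "i < 2 * n" for i j
  proof -
    have "(\<Sum>k<2 * n. Jmat n i k * X k j) = (\<Sum>k<2 * n. if op n i = k then sg i * X k j else 0)"
      using that by (intro sum.cong) (auto simp: Jmat_def op_def sg_def)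
    then show ?thesis
      using that by simp
  qed
  have sg_op: "sg (op n i) = - sg i" if "i < 2 * n" for i
    using that by (auto simp: sg_def op_def)
  have L: "?L \<longleftrightarrow> (\<forall>i<2 * n. \<forall>j<2 * n. - sg j * X (op n j) i + sg i * X (op n i) j = 0)"
    by (simp add: 1 2)
  also have "\<dots> \<longleftrightarrow> (\<forall>i<2 * n. \<forall>j<2 * n. - sg j * X (op n j) (op n i) - sg i * X i j = 0)"
    (is "(\<forall>i<2 * n. \<forall>j<2 * n. ?A i j) \<longleftrightarrow> (\<forall>i<2 * n. \<forall>j<2 * n. ?B i j)")
  proof -
    have "?B i j \<longleftrightarrow> ?A (op n i) j" if "i < 2 * n" for i j
      using that by (simp add: sg_op)
    moreover have "?A i j \<longleftrightarrow> ?B (op n i) j" if "i < 2 * n" for i j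
      using that by (simp add: sg_op)
    ultimately show ?thesis
      by (meson op_simps(1))
  qed
  also have "\<dots> \<longleftrightarrow> ?R"
  proof -
    have "- sg j * X (op n j) (op n i) - sg i * X i j = 0 \<longleftrightarrow>
        X (op n j) (op n i) = - (if (i < n) = (j < n) then 1 else - 1) * X i j" for i j
    proof -
      have *: "- A - B = 0 \<longleftrightarrow> A = - B" "- A + B = 0 \<longleftrightarrow> A = B"
        "A + B = 0 \<longleftrightarrow> A = - B" "A - B = 0 \<longleftrightarrow> A = B" "- A = B \<longleftrightarrow> A = - B"
        for A B :: complex
      proof -
        show "A + B = 0 \<longleftrightarrow> A = - B"
          by (rule eq_neg_iff_add_eq_0[symmetric])
        moreover have "- A - B = - (A + B)"
          by simp
        ultimately show "- A - B = 0 \<longleftrightarrow> A = - B"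
          by (simp only: neg_equal_0_iff_equal)
        show "A - B = 0 \<longleftrightarrow> A = B"
          by (rule right_minus_eq)
        show "- A = B \<longleftrightarrow> A = - B"
          by auto
        have "- A + B = B - A"
          by simp
        then show "- A + B = 0 \<longleftrightarrow> A = B"
          by (simp only: right_minus_eq) (rule eq_commute)
      qed
      show ?thesis
        by (cases "i < n"; cases "j < n")
          (simp_all only: sg_def if_True if_False simp_thms minus_minus mult_1_left mult_minus_left
            diff_minus_eq_add *)
    qed
    then show ?thesis
      by simp
  qed
  finally show ?thesis .
qed

lemma three_blocks:
  fixes a c d :: nat
  assumes "\<And>k. a + c + d \<le> k \<Longrightarrow> Z k \<Longrightarrow> B k"
  shows "(\<forall>k\<in>{..<a + c + d}. B k \<and> (if k < a then P1 k else if k < a + c then P2 k else P3 k)) \<and>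
      (\<forall>k. k \<notin> {..<a + c + d} \<longrightarrow> Z k) \<longleftrightarrow>
    (\<forall>k. B k) \<and> (\<forall>k\<ge>a + c + d. Z k) \<and> (\<forall>k<a. P1 k) \<and> (\<forall>k. a \<le> k \<and> k < a + c \<longrightarrow> P2 k) \<and>
      (\<forall>k. a + c \<le> k \<and> k < a + c + d \<longrightarrow> P3 k)"
    (is "?L \<longleftrightarrow> ?R")
proof
  assume L: ?L
  then have Z: "Z k" if "a + c + d \<le> k" for k
    using that by (meson lessThan_iff not_less)
  have L: "B k \<and> (if k < a then P1 k else if k < a + c then P2 k else P3 k)" if "k < a + c + d" for k
    using L that by blast
  have "B k" for k
    using L[of k] assms[of k] Z[of k] by (cases "k < a + c + d") auto
  moreover have "P1 k" if "k < a" for k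
    using L[of k] that by simp
  moreover have "P2 k" if "a \<le> k" "k < a + c" for k
    using L[of k] that by simp
  moreover have "P3 k" if "a + c \<le> k" "k < a + c + d" for k
    using L[of k] that by simp
  ultimately show ?R
    using Z by blast
next
  assume R: ?R
  then show ?L
    by (auto simp: not_less)
qed

lemma carr_M_sum:
  "x \<in> carr (M_sum n a c d) \<longleftrightarrow> supp (2 * n) x \<and> (\<forall>k\<ge>a + c + d. x k = 0) \<and>
     (\<forall>k<a. (\<Sum>i<2 * n. x k i i) = 0) \<and>
     (\<forall>k. a \<le> k \<and> k < a + c \<longrightarrow> (\<forall>i<2 * n. \<forall>j<2 * n.
        x k (op n j) (op n i) = - (if (i < n) = (j < n) then 1 else - 1) * x k i j)) \<and>
     (\<forall>k. a + c \<le> k \<and> k < a + c + d \<longrightarrow> (\<forall>i j. x k j i = - x k i j))"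
proof -
  let ?Ls = "\<lambda>k. if k < a then sl_lie (2 * n) else if k < a + c then sp_lie n else so_lie (2 * n)"
  have mem: "X \<in> carr (?Ls k) \<longleftrightarrow> (\<forall>i j. 2 * n \<le> i \<or> 2 * n \<le> j \<longrightarrow> X i j = 0) \<and>
      (if k < a then (\<Sum>i<2 * n. X i i) = 0 else if k < a + c
       then (\<forall>i<2 * n. \<forall>j<2 * n. X (op n j) (op n i) = - (if (i < n) = (j < n) then 1 else - 1) * X i j)
       else (\<forall>i j. X j i = - X i j))" for X k
  proof (cases "k < a"; cases "k < a + c")
    show ?thesis if "k < a"
      using that by (simp add: sl_lie_def mat_lie_def)
    show ?thesis if "\<not> k < a" "k < a + c"
      unfolding sp_condition[symmetric] using that by (simp only: if_True if_False sp_lie_def mat_lie_def lie.simps mem_Collect_eq)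
    show ?thesis if "\<not> k < a" "\<not> k < a + c"
      using that by (simp only: if_True if_False so_lie_def mat_lie_def lie.simps mem_Collect_eq)
  qed simp_all
  have zer: "zer (?Ls k) = 0" for k
    by (auto simp: sl_lie_def sp_lie_def so_lie_def mat_lie_def fun_eq_iff)
  have carr: "x \<in> carr (M_sum n a c d) \<longleftrightarrow> (\<forall>k\<in>{..<a + c + d}. x k \<in> carr (?Ls k)) \<and>
      (\<forall>k. k \<notin> {..<a + c + d} \<longrightarrow> x k = 0)"
    unfolding M_sum_def dsum_def lie.simps mem_Collect_eq zer ..
  show ?thesis
    unfolding carr mem supp_def by (subst three_blocks) (simp_all only: zero_fun_apply, blast)
qed

text \<open>Closure of the concrete sum under its operations is transported from \<open>L\<close>
  along the isomorphism, which avoids checking it for each matrix family.\<close>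

lemma iso_closed:
  assumes "lie_algebra L" "lie_iso L M \<phi>" "x \<in> carr M" "y \<in> carr M"
  shows "pls M x y \<in> carr M" "scl M t x \<in> carr M" "brk M x y \<in> carr M"
proof -
  interpret lie L using assms(1) by unfold_locales
  have bij: "bij_betw \<phi> (carr L) (carr M)"
    using assms(2) unfolding lie_iso_def by blast
  obtain x' y' where x: "x = \<phi> x'" "x' \<in> carr L" and y: "y = \<phi> y'" "y' \<in> carr L"
    using assms(3,4) bij_betw_imp_surj_on[OF bij] by blast
  have "pls M x y = \<phi> (pls L x' y')" "scl M t x = \<phi> (scl L t x')" "brk M x y = \<phi> (brk L x' y')"
    using assms(2) x y unfolding lie_iso_def by simp_all
  then show "pls M x y \<in> carr M" "scl M t x \<in> carr M" "brk M x y \<in> carr M"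
    using x y bij_betw_apply[OF bij] by simp_all
qed

section \<open>Root vectors as elements of the direct sum, and the epimorphism\<close>

lemma Y_supp:
  assumes "a < 2 * n" "b < 2 * n"
  shows "supp (2 * n) (Y n g h a b)"
proof -
  have "op n a < 2 * n" "op n b < 2 * n"
    using assms by simp_all
  then show ?thesis
    using assms unfolding supp_def Y_def E_def by (auto simp del: op_simps)
qed

lemma Y_trace:
  assumes "indep n a b"
  shows "(\<Sum>i<N. Y n g h a b k i i) = 0"
  using indepD[OF assms] by (intro sum.neutral) (auto simp: Y_def E_def)

lemma Y_op:
  assumes "a < 2 * n" "b < 2 * n" "i < 2 * n" "j < 2 * n"
  shows "Y n g h a b k (op n j) (op n i) = Y n h g a b k i j"
proof -
  have "op n j = a \<and> op n i = b \<longleftrightarrow> i = op n b \<and> j = op n a"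
    "op n j = op n b \<and> op n i = op n a \<longleftrightarrow> i = a \<and> j = b"
    using assms op_simps(2) by metis+
  then show ?thesis
    by (simp add: Y_def E_def)
qed

text \<open>Twisted transposition swaps the partner positions and hence \<open>g\<close> and
  \<open>h\<close>. As the sign squares to 1, the relation between \<open>g\<close> and
  \<open>h\<close> is symmetric, and both partner positions carry the same sign.\<close>

lemma Y_form:
  assumes ab: "a < 2 * n" "b < 2 * n" and ij: "i < 2 * n" "j < 2 * n"
    and h: "h k = - (if (a < n) = (b < n) then 1 else t) * g k" and t: "t * t = 1"
  shows "Y n g h a b k (op n j) (op n i) = - (if (i < n) = (j < n) then 1 else t) * Y n g h a b k i j"
proof -
  have half: "op n x < n \<longleftrightarrow> \<not> x < n" if "x < 2 * n" for x
    using that by (auto simp: op_def)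
  define e where "e = (if (a < n) = (b < n) then 1 else t)"
  have ee: "e * (e * z) = z" for z
  proof -
    have "e * (e * z) = (e * e) * z"
      by (simp only: mult.assoc)
    also have "e * e = 1"
      using t by (simp add: e_def)
    finally show ?thesis by simp
  qed
  have hk: "h k = - (e * g k)" and gk: "g k = - (e * h k)"
    using h ee by (simp_all add: e_def[symmetric])
  have E: "E g a b k i j = of_bool (i = a \<and> j = b) * g k" for g a b
    by (simp add: E_def)
  let ?c = "if (i < n) = (j < n) then 1 else t"
  have c: "?c = e" if "i = a \<and> j = b \<or> i = op n b \<and> j = op n a"
    using that half ab by (auto simp: e_def)
  have "of_bool (i = a \<and> j = b) * h k = - ?c * (of_bool (i = a \<and> j = b) * g k)"
  proof (cases "i = a \<and> j = b")
    case True
    then have "?c = e"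
      using c by blast
    then show ?thesis
      using True hk by (simp only:) simp
  next
    case False
    then show ?thesis
      by (simp only: of_bool_eq mult_zero_left mult_zero_right)
  qed
  moreover have "of_bool (i = op n b \<and> j = op n a) * g k = - ?c * (of_bool (i = op n b \<and> j = op n a) * h k)"
  proof (cases "i = op n b \<and> j = op n a")
    case True
    then have "?c = e"
      using c by blast
    then show ?thesis
      unfolding gk using True by simp
  next
    case False
    then show ?thesis
      by (simp only: of_bool_eq mult_zero_left mult_zero_right)
  qed
  ultimately show ?thesis
    unfolding Y_op[OF ab ij] unfolding Y_def plus_fun_apply E distrib_left by (simp only:)
qed

text \<open>Integers from 2 on are distinct, and no product of two of them is 1. The self-inverse
  values 1 and -1 stay free for the symplectic and the orthogonal summand.\<close>

definition qv :: "nat \<Rightarrow> nat \<Rightarrow> nat \<Rightarrow> nat \<Rightarrow> complex" where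
  "qv a c d k = (if k < a then of_nat (k + 2) else if k < a + c then 1 else if k < a + c + d then - 1 else 0)"

lemma qv_nonzero: "k < a + c + d \<Longrightarrow> qv a c d k \<noteq> 0"
  using of_nat_eq_0_iff[of "k + 2", where 'a = complex] by (simp add: qv_def del: of_nat_add)

lemma qv_outside: "\<not> k < a + c + d \<Longrightarrow> qv a c d k = 0"
  by (simp add: qv_def)

lemma qv_sep:
  assumes "c \<le> 1" "d \<le> 1" "k < a + c + d" "l < a + c + d" "k \<noteq> l"
  shows "qv a c d k \<noteq> qv a c d l \<and> qv a c d k * qv a c d l \<noteq> 1"
proof -
  define z :: "nat \<Rightarrow> int" where
    "z k = (if k < a then int (k + 2) else if k < a + c then 1 else - 1)" for k
  have q: "qv a c d k = of_int (z k)" if "k < a + c + d" for k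
    using that by (simp add: qv_def z_def)
  consider "k < a" "l < a" | "k < a" "\<not> l < a" | "\<not> k < a" "l < a" | "\<not> k < a" "\<not> l < a"
    by blast
  then have "z k \<noteq> z l \<and> z k * z l \<noteq> 1"
  proof cases
    case 1
    have "1 < int (k + 2) * int (l + 2)"
      by (rule less_1_mult) auto
    then show ?thesis
      using 1 assms(5) by (simp add: z_def)
  next
    case 2
    then show ?thesis by (simp add: z_def)
  next
    case 3
    then show ?thesis by (simp add: z_def)
  next
    case 4
    \<comment> \<open>With \<open>c\<close> and \<open>d\<close> at most 1, two distinct indices
      beyond the special linear block carry the parameters 1 and -1, whose product is -1.\<close>
    then have "k < a + c \<longleftrightarrow> \<not> l < a + c"
      using assms by linarith
    then show ?thesis
      using 4 by (auto simp: z_def)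
  qed
  moreover have "qv a c d k * qv a c d l = of_int (z k * z l)"
    using q assms(3,4) by simp
  ultimately show ?thesis
    using q assms(3,4) by (simp only: of_int_eq_iff of_int_eq_1_iff) simp
qed

text \<open>The map evaluates at the twisted generators and then conjugates the orthogonal block. It
  lands in the sum because the generators do; it is onto because \<open>G_complete\<close> applies
  to the tuple before conjugation.\<close>

lemma M_sum_epi:
  assumes n: "3 \<le> n" and cd: "c \<le> 1" "d \<le> 1"
    and L: "lie_algebra L" and iso: "lie_iso L (M_sum n a c d) \<phi>"
  shows "\<exists>f. lie_epi (free_lie n) (M_sum n a c d) f \<and> gim_rels n \<subseteq> lie_kernel (free_lie n) f"
proof -
  let ?K = "{..<a + c + d}" and ?q = "qv a c d" and ?M = "M_sum n a c d" and ?F = "free_lie n"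
  interpret tw: twisted n ?K ?q
    by unfold_locales (use n qv_nonzero[of _ a c d] qv_outside[of _ a c d] in auto)
  interpret F: lie ?F
    by unfold_locales (rule lie_algebra_free_lie)
  note closed = iso_closed[OF L iso, unfolded M_sum_sel]
  define f where "f x = cj n (a + c) (tw.ev x)" for x
  have supp_gen: "supp (2 * n) (tw.gen_val x)" for x
    using tw.gen_val_bounded unfolding supp_def by blast
  have supp_ev: "supp (2 * n) (tw.ev x)" if "x \<in> carr ?F" for x
  proof -
    have "supp (2 * n) (word_eval (2 * n) tw.gen_val w)" for w
    proof (induction w)
      case Nil
      then show ?case by (auto simp: supp_def)
    next
      case (Cons x w)
      then show ?case
        using supp_tmul[OF supp_gen] by simp
    qed
    then show ?thesis
      unfolding tw.ev_def eval_def supp_def sum_tup_apply tscale_def by simp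
  qed
  have f_hom: "f (pls ?F x y) = f x + f y" "f (scl ?F t x) = tscale t (f x)"
    "f (brk ?F x y) = tbr (2 * n) (f x) (f y)" if "x \<in> carr ?F" "y \<in> carr ?F" for x y t
    using supp_ev that by (simp_all add: f_def tw.ev_hom cj_linear cj_tbr)
  have f_zero: "f (zer ?F) = 0"
    unfolding free_lie_sel(1) by (simp add: f_def tw.ev_zero cj_def tmul_linear)
  have Y_carr: "cj n (a + c) (Y n tw.u s x y) \<in> carr ?M"
    if "indep n x y" and out: "\<And>k. a + c + d \<le> k \<Longrightarrow> s k = 0"
      and sp: "\<And>k. a \<le> k \<Longrightarrow> k < a + c \<Longrightarrow> s k = - (if (x < n) = (y < n) then 1 else - 1)"
      and so: "\<And>k. a + c \<le> k \<Longrightarrow> k < a + c + d \<Longrightarrow> s k = - 1" for s x y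
  proof -
    let ?Y = "Y n tw.u s x y"
    have xy: "x < 2 * n" "y < 2 * n"
      using that(1) by (auto simp: indep_def)
    have Y: "supp (2 * n) ?Y"
      using xy by (rule Y_supp)
    note below = cj_below(1)[OF Y]
    have c2: "cj n (a + c) ?Y k = 0" if "a + c + d \<le> k" for k
    proof -
      have "?Y k = 0"
        using out[OF that] that by (simp add: Y_def E_def tw.u_def fun_eq_iff)
      then show ?thesis
        by (simp add: cj_def tmul_def fun_eq_iff)
    qed
    have c3: "(\<Sum>i<2 * n. cj n (a + c) ?Y k i i) = 0" if "k < a" for k
      using that below[of k "a + c"] Y_trace[OF \<open>indep n x y\<close>] by simp
    have c4: "cj n (a + c) ?Y k (op n j) (op n i) = - (if (i < n) = (j < n) then 1 else - 1) * cj n (a + c) ?Y k i j"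
      if "a \<le> k" "k < a + c" "i < 2 * n" "j < 2 * n" for k i j
      unfolding below[OF that(2)]
      by (rule Y_form[OF xy that(3,4)]) (use sp[OF that(1,2)] that in \<open>auto simp: tw.u_def\<close>)
    have c5: "cj n (a + c) ?Y k j i = - cj n (a + c) ?Y k i j"
      if k: "a + c \<le> k" "k < a + c + d" for k i j
    proof (rule cj_skew[OF k(1)])
      fix i j assume ij: "i < 2 * n" "j < 2 * n"
      have "s k = - (if (x < n) = (y < n) then 1 else 1) * tw.u k"
        using so[OF k] k by (simp add: tw.u_def)
      from Y_form[where h = s and g = tw.u and k = k and t = 1, OF xy ij this] show "?Y k (op n j) (op n i) = - ?Y k i j"
        by simp
    qed
    show ?thesis
      unfolding carr_M_sum
      by (intro conjI allI impI supp_cj(1)[OF Y]; (elim conjE)?; rule c2 c3 c4 c5; assumption)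
  qed
  have ge: "f (gen_e n i) \<in> carr ?M" and gf: "f (gen_f n i) \<in> carr ?M" if i: "i \<in> {1..n}" for i
  proof -
    show "f (gen_e n i) \<in> carr ?M"
      unfolding f_def tw.ev_gen[OF i] tw.ge_def
      by (rule Y_carr[OF tw.indep_adjacent[OF i]])
        (use i in \<open>auto simp: tw.s_def tw.u_def qv_def\<close>)
    show "f (gen_f n i) \<in> carr ?M"
      unfolding f_def tw.ev_gen[OF i] tw.gf_def
      by (rule Y_carr[OF indep_sym[OF tw.indep_adjacent[OF i]]])
        (use i in \<open>auto simp: tw.s'_def tw.u_def tw.r_def qv_def\<close>)
  qed
  \<comment> \<open>The coroot is the bracket of two images already in the sum, so closure
    suffices.\<close>
  have gh: "f (gen_h n i) \<in> carr ?M" if i: "i \<in> {1..n}" for i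
  proof -
    have "f (gen_h n i) = f (brk ?F (gen_e n i) (gen_f n i))"
      using gens_free_lie[OF i] unfolding f_def by (simp add: tw.ev_hom tw.ev_gen[OF i] tw.rel_coroot[OF i])
    also have "\<dots> = tbr (2 * n) (f (gen_e n i)) (f (gen_f n i))"
      using gens_free_lie[OF i] by (simp add: f_hom)
    finally show ?thesis
      using closed(3)[OF ge[OF i] gf[OF i]] by simp
  qed
  \<comment> \<open>The free Lie algebra is the least subalgebra containing the letters; hence it is
    enough that the preimage of the sum is a subalgebra containing them.\<close>
  let ?W = "{x \<in> carr ?F. f x \<in> carr ?M}"
  have "subalgebra assoc_lie ?W"
  proof -
    have "0 \<in> carr ?M"
      unfolding carr_M_sum supp_def by simp
    moreover have "pls assoc_lie = pls ?F" "scl assoc_lie = scl ?F" "brk assoc_lie = brk ?F" "zer assoc_lie = zer ?F"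
      by (simp_all add: free_lie_eq)
    moreover have "carr ?F \<subseteq> carr assoc_lie"
      using free_lie_carr by (simp add: assoc_lie_sel)
    ultimately show ?thesis
      unfolding subalgebra_def subspace_def
      using f_hom closed f_zero by auto
  qed
  moreover have "gim_gens n \<subseteq> ?W"
    using ge gf gh gens_free_lie unfolding gim_gens_def by blast
  ultimately have "lie_gen assoc_lie (gim_gens n) \<subseteq> ?W"
    by (rule lie_gen_least)
  then have sub: "f ` carr ?F \<subseteq> carr ?M"
    by (auto simp: free_lie_eq)
  let ?G = "tw.ev ` carr ?F"
  have G_gens: "tw.ge i \<in> ?G" "tw.gf i \<in> ?G" if i: "i \<in> {1..n}" for i
    unfolding tw.ev_gen[OF i, symmetric] by (intro imageI gens_free_lie i)+
  have G_closed: "tw.ev x + tw.ev y \<in> ?G" "tscale t (tw.ev x) \<in> ?G" "tw.br (tw.ev x) (tw.ev y) \<in> ?G"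
    if "x \<in> carr ?F" "y \<in> carr ?F" for x y t
    unfolding tw.ev_hom[OF that, symmetric] by (intro imageI F.closed that)+
  interpret tg: twisted_gen n ?K ?q ?G
  proof (intro twisted_gen.intro twisted_gen_axioms.intro)
    show "twisted n ?K ?q"
      by (rule tw.twisted_axioms)
    show "?q k \<noteq> ?q l \<and> ?q k * ?q l \<noteq> 1" if "k \<in> ?K" "l \<in> ?K" "k \<noteq> l" for k l
      using qv_sep[OF cd] that by blast
    show "x + y \<in> ?G" if "x \<in> ?G" "y \<in> ?G" for x y
      using that G_closed(1) by blast
    show "tscale t x \<in> ?G" if "x \<in> ?G" for x t
      using that G_closed(2) by blast
    show "tw.br x y \<in> ?G" if "x \<in> ?G" "y \<in> ?G" for x y
      using that G_closed(3) by blast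
  qed (use G_gens in simp_all)
  have sup: "y \<in> f ` carr ?F" if "y \<in> carr ?M" for y
  proof -
    have ys: "supp (2 * n) y"
      and y_out: "\<And>k. a + c + d \<le> k \<Longrightarrow> y k = 0"
      and y_sl: "\<And>k. k < a \<Longrightarrow> (\<Sum>i<2 * n. y k i i) = 0"
      and y_sp: "\<And>k i j. a \<le> k \<Longrightarrow> k < a + c \<Longrightarrow> i < 2 * n \<Longrightarrow> j < 2 * n \<Longrightarrow>
        y k (op n j) (op n i) = - (if (i < n) = (j < n) then 1 else - 1) * y k i j"
      and y_so: "\<And>k i j. a + c \<le> k \<Longrightarrow> k < a + c + d \<Longrightarrow> y k j i = - y k i j"
      using that unfolding carr_M_sum by blast+
    note below = cj_below(2)[OF ys]
    have special: "tg.p k * tg.p k = 1 \<longleftrightarrow> \<not> k < a" if "k < a + c + d" for k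
    proof (cases "k < a")
      case True
      have "tg.p k * tg.p k = of_nat ((k + 2) * (k + 2))"
        using True by (simp add: tg.p_def qv_def algebra_simps)
      then show ?thesis
        using True by (simp only: of_nat_eq_1_iff) simp
    qed (use that in \<open>auto simp: tg.p_def qv_def\<close>)
    have "cj' n (a + c) y \<in> ?G"
    proof (rule tg.G_complete)
      show "cj' n (a + c) y k i j = 0" if "k \<notin> ?K \<or> 2 * n \<le> i \<or> 2 * n \<le> j" for k i j
      proof (cases "2 * n \<le> i \<or> 2 * n \<le> j")
        case True
        then show ?thesis
          using supp_cj(2)[OF ys] unfolding supp_def by blast
      next
        case False
        then have "y k = 0"
          using that y_out by auto
        then show ?thesis
          by (simp add: cj'_def tmul_def)
      qed
      show "(\<Sum>i<2 * n. cj' n (a + c) y k i i) = 0" if "k \<in> ?K" "tg.p k * tg.p k \<noteq> 1" for k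
        using that special[of k] below[of k "a + c"] y_sl by auto
      show "cj' n (a + c) y k (op n j) (op n i) = - tg.coef k i j * cj' n (a + c) y k i j"
        if k: "k \<in> ?K" "tg.p k * tg.p k = 1" and ij: "i < 2 * n" "j < 2 * n" for k i j
      \<comment> \<open>The symplectic parameter 1 gives \<open>p k = -1\<close>, so
        \<open>coef\<close> is the sign in \<open>sp_condition\<close>. The orthogonal parameter -1
        gives \<open>p k = 1\<close>, and the condition is skewness with the base change
        undone.\<close>
      proof (cases "k < a + c")
        case True
        then have "tg.coef k i j = (if (i < n) = (j < n) then 1 else - 1)"
          using k special[of k] by (auto simp: tg.coef_def tg.p_def qv_def)
        then show ?thesis
          unfolding below[OF True] using y_sp[OF _ True ij] k special[of k] by simp
      next
        case False
        then have "tg.coef k i j = 1"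
          using k special[of k] by (auto simp: tg.coef_def tg.p_def qv_def)
        moreover have "cj' n (a + c) y k (op n j) (op n i) = - cj' n (a + c) y k i j"
          using False k(1) by (intro cj'_skew y_so ij) simp_all
        ultimately show ?thesis
          by simp
      qed
    qed
    then obtain x where x: "x \<in> carr ?F" "cj' n (a + c) y = tw.ev x"
      by blast
    then have "f x = y"
      unfolding f_def x(2)[symmetric] by (intro cj_cj' ys)
    then show ?thesis
      using x by blast
  qed
  have onto: "f ` carr ?F = carr ?M"
    using sub sup by blast
  have "lie_epi ?F ?M f"
    unfolding lie_epi_def M_sum_sel by (intro conjI ballI allI onto f_hom; assumption)
  moreover have "gim_rels n \<subseteq> lie_kernel ?F f"
  proof
    fix x assume "x \<in> gim_rels n"
    from tw.gim_rels_kernel[OF this] show "x \<in> lie_kernel ?F f"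
      unfolding lie_kernel_def mem_Collect_eq f_zero by (simp add: f_def cj_def tmul_linear)
  qed
  ultimately show ?thesis
    by blast
qed

theorem theorem3p1:
  fixes n a c d :: nat and L :: "('a, 'b) lie_scheme"
  assumes "3 \<le> n"
    and "of_type_M n a c d L"
  shows "\<exists>I. lie_ideal (gim n) I \<and> lie_isomorphic (quot (gim n) I) L"
proof -
  have cd: "c \<le> 1" "d \<le> 1" and L: "lie_algebra L"
    using assms(2) unfolding of_type_M_def semisimple_def by blast+
  obtain \<phi> where iso: "lie_iso L (M_sum n a c d) \<phi>"
    using assms(2) unfolding of_type_M_def lie_isomorphic_def by blast
  obtain f where f: "lie_epi (free_lie n) (M_sum n a c d) f"
    and rels: "gim_rels n \<subseteq> lie_kernel (free_lie n) f"
    using M_sum_epi[OF assms(1) cd L iso] by blast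
  interpret F: lie "free_lie n"
    by unfold_locales (rule lie_algebra_free_lie)
  define g where "g x = inv_into (carr L) \<phi> (f x)" for x
  have g: "lie_epi (free_lie n) L g"
    unfolding g_def using f L iso by (rule lie_epi_inverse_iso)
  have "lie_kernel (free_lie n) f \<subseteq> lie_kernel (free_lie n) g"
    by (auto simp: lie_kernel_def g_def)
  \<comment> \<open>This ideal serves twice: it makes the family intersected in
    \<open>ideal_gen\<close> nonempty, so that the intersection is an ideal, and it bounds the
    intersection from above.\<close>
  then have mem: "lie_kernel (free_lie n) g \<in> {I. lie_ideal (free_lie n) I \<and> gim_rels n \<subseteq> I}"
    using rels F.lie_ideal_kernel[OF g] by blast
  let ?R = "ideal_gen (free_lie n) (gim_rels n)"
  have "lie_ideal (free_lie n) ?R"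
    unfolding ideal_gen_def using mem by (intro F.lie_ideal_Inter) blast+
  moreover have "?R \<subseteq> lie_kernel (free_lie n) g"
    unfolding ideal_gen_def using mem by (rule Inter_lower)
  ultimately show ?thesis
    unfolding gim_def by (rule F.quot_quot_isomorphic[OF g])
qed

end
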